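(* Let $m\ge1$, let $f_1,\dots,f_m:(0,\infty)\to\mathbb{R}$ be convex functions with $f_i(1)=0$ for each $i$, let $D_1,\dots,D_m\ge 0$, and let $D_f$ be the primitive divergence corresponding to $f=u_s$ for some $s>0$. Then $$A(D_1,\dots,D_m)=-\frac{|s-1|}{2}+\frac12\max_{\sigma\in\mathcal{S}_m}V_\sigma(D_1,\dots,D_m).$$ Consequently, $A(D_1,\dots,D_m)$ can be computed from the optimal values $V_\sigma(D_1,\dots,D_m)$ of the $|\mathcal{S}_m|=m+3$ convex optimization problems defining $V_\sigma$, $\sigma\in\mathcal{S}_m$.
   Context: For a convex function $g:(0,\infty)\to\mathbb{R}$ with $g(1)=0$, put $g(0):=\lim_{x\downarrow 0}g(x)$ and $g'(\infty):=\lim_{x\uparrow\infty}g(x)/x$ (both exist, possibly $+\infty$). For probability measures $P,Q$ on a common measurable space with densities $p,q$ with respect to a common dominating measure, the $g$-divergence is $D_g(P||Q):=\int_{\{q>0\}} g(p/q)\,dQ+g'(\infty)P\{q=0\}$ (with $\infty\cdot 0=0$). For $s>0$ let $u_s(t):=\min(1,s)-\min(t,s)$, $t\in(0,\infty)$; the divergence $D_{u_s}$ is called a primitive divergence. $A(D_1,\dots,D_m):=\sup\{D_f(P||Q): D_{f_i}(P||Q)\le D_i\ \forall i=1,\dots,m\}$, where $(P,Q)$ ranges over all pairs of probability measures on all possible measurable spaces. $\mathcal{S}_m:=\{\sigma\in\{-1,1\}^{m+2}:\sigma_i\le\sigma_j\text{ for }i\le j\}$. For $\sigma\in\mathcal{S}_m$,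 $V_\sigma(D_1,\dots,D_m)$ is the optimal value of the following convex problem: maximize $\sum_{j=1}^{m+2}\sigma_j(p_j-sq_j)$ over $p,q\in[0,1]^{m+2}$ subject to $\sum_j p_j=\sum_j q_j=1$ and, for each $i=1,\dots,m$, $\sum_{j:q_j>0}q_jf_i(p_j/q_j)+f_i'(\infty)\sum_{j:q_j=0}p_j\le D_i$. *)

theory Defs
  imports "HOL-Analysis.Analysis" "HOL-Probability.Probability"
begin

section \<open>Divergences\<close>

text \<open>
  The value \<open>g(0)\<close> and the slope \<open>g'(\<infinity>)\<close> may be \<open>+\<infinity>\<close>, so they are taken as limits in
  \<^typ>\<open>ereal\<close>. For \<open>g\<close> convex on \<open>(0,\<infinity>)\<close> both limits exist and differ from \<open>-\<infinity>\<close>. The value of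
  \<^term>\<open>g 0\<close> as a HOL function is never used.
\<close>

definition ext_at_zero :: "(real \<Rightarrow> real) \<Rightarrow> real \<Rightarrow> ereal" where
  "ext_at_zero g t =
     (if t > 0 then ereal (g t) else Lim (at_right 0) (\<lambda>x. ereal (g x)))"

definition slope_at_inf :: "(real \<Rightarrow> real) \<Rightarrow> ereal" where
  "slope_at_inf g = Lim at_top (\<lambda>x. ereal (g x / x))"

text \<open>
  Integral of an \<^typ>\<open>ereal\<close>-valued function as positive part minus negative part
  (\<^const>\<open>e2ennreal\<close> sends negative arguments to 0). In the integrals below the negative part is
  finite, since a convex \<open>g\<close> has an affine minorant.
\<close>

definition ereal_integral :: "'a measure \<Rightarrow> ('a \<Rightarrow> ereal) \<Rightarrow> ereal" where
  "ereal_integral M h =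
     enn2ereal (\<integral>\<^sup>+x. e2ennreal (h x) \<partial>M) - enn2ereal (\<integral>\<^sup>+x. e2ennreal (- h x) \<partial>M)"

text \<open>The divergence formula for given densities \<open>p\<close>, \<open>q\<close> of \<open>P\<close>, \<open>Q\<close>; here \<open>\<infinity> * 0 = 0\<close>.\<close>

definition gdiv_formula ::
  "(real \<Rightarrow> real) \<Rightarrow> 'a measure \<Rightarrow> 'a measure \<Rightarrow> ('a \<Rightarrow> real) \<Rightarrow> ('a \<Rightarrow> real) \<Rightarrow> ereal" where
  "gdiv_formula g P Q p q =
     ereal_integral Q (\<lambda>x. ext_at_zero g (p x / q x) * indicator {x. q x > 0} x)
     + slope_at_inf g * ereal (measure P {x \<in> space P. q x = 0})"

definition sum_meas :: "'a measure \<Rightarrow> 'a measure \<Rightarrow> 'a measure" where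
  "sum_meas P Q = measure_of (space P) (sets P) (\<lambda>A. emeasure P A + emeasure Q A)"

text \<open>
  The dominating measure is fixed to be \<open>P + Q\<close>; \<open>gdiv_eq_formula\<close> below shows that every other
  common dominating measure, and every choice of densities, gives the same value.
\<close>

definition gdiv :: "(real \<Rightarrow> real) \<Rightarrow> 'a measure \<Rightarrow> 'a measure \<Rightarrow> ereal" where
  "gdiv g P Q =
     gdiv_formula g P Q
       (\<lambda>x. enn2real (RN_deriv (sum_meas P Q) P x))
       (\<lambda>x. enn2real (RN_deriv (sum_meas P Q) Q x))"

definition u_prim :: "real \<Rightarrow> real \<Rightarrow> real" where
  "u_prim s t = min 1 s - min t s"

text \<open>
  HOL cannot quantify over all measurable spaces at once, so the supremum over pairs of probability
  measures is taken for the measurable spaces carried by subsets of one type \<^typ>\<open>'a\<close>.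
  Small types do not carry enough measures; the supremum over all spaces is the value at a type
  that dominates the value at every other type.
\<close>

definition max_div ::
  "'a itself \<Rightarrow> nat \<Rightarrow> (real \<Rightarrow> real) \<Rightarrow> (nat \<Rightarrow> real \<Rightarrow> real) \<Rightarrow> (nat \<Rightarrow> real) \<Rightarrow> ereal" where
  "max_div _ m f fs D =
     Sup {gdiv f P Q | P Q :: 'a measure.
            prob_space P \<and> prob_space Q \<and> sets P = sets Q \<and>
            (\<forall>i\<in>{1..m}. gdiv (fs i) P Q \<le> ereal (D i))}"

section \<open>The finite-dimensional problems\<close>

text \<open>Sign vectors are extensional functions, so that each of them is counted once.\<close>

definition sign_vectors :: "nat \<Rightarrow> (nat \<Rightarrow> real) set" where
  "sign_vectors m = {\<sigma> \<in> {1..m + 2} \<rightarrow>\<^sub>E {-1, 1}. mono_on {1..m + 2} \<sigma>}"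

definition feasible ::
  "nat \<Rightarrow> (nat \<Rightarrow> real \<Rightarrow> real) \<Rightarrow> (nat \<Rightarrow> real) \<Rightarrow> (nat \<Rightarrow> real) \<Rightarrow> (nat \<Rightarrow> real) \<Rightarrow> bool" where
  "feasible m fs D p q \<longleftrightarrow>
     (\<forall>j\<in>{1..m + 2}. p j \<in> {0..1} \<and> q j \<in> {0..1}) \<and>
     (\<Sum>j=1..m + 2. p j) = 1 \<and> (\<Sum>j=1..m + 2. q j) = 1 \<and>
     (\<forall>i\<in>{1..m}.
        (\<Sum>j\<in>{j \<in> {1..m + 2}. q j > 0}. ereal (q j) * ext_at_zero (fs i) (p j / q j))
        + slope_at_inf (fs i) * ereal (\<Sum>j\<in>{j \<in> {1..m + 2}. q j = 0}. p j)
        \<le> ereal (D i))"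

definition opt_value ::
  "nat \<Rightarrow> real \<Rightarrow> (nat \<Rightarrow> real \<Rightarrow> real) \<Rightarrow> (nat \<Rightarrow> real) \<Rightarrow> (nat \<Rightarrow> real) \<Rightarrow> ereal" where
  "opt_value m s fs D \<sigma> =
     Sup {ereal (\<Sum>j=1..m + 2. \<sigma> j * (p j - s * q j)) | p q. feasible m fs D p q}"

section \<open>Independence of the dominating measure\<close>

lemma sum_meas_density:
  fixes p q :: "'a \<Rightarrow> ennreal"
  assumes [measurable]: "p \<in> borel_measurable M" "q \<in> borel_measurable M"
  shows "sum_meas (density M p) (density M q) = density M (\<lambda>x. p x + q x)"
proof (rule measure_eqI)
  show "sets (sum_meas (density M p) (density M q)) = sets (density M (\<lambda>x. p x + q x))"
    unfolding sum_meas_def using sets.sigma_sets_eq[of M] by (simp add: sets.space_closed)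
next
  fix A assume "A \<in> sets (sum_meas (density M p) (density M q))"
  then have A: "A \<in> sets M"
    unfolding sum_meas_def using sets.sigma_sets_eq[of M] by (simp add: sets.space_closed)
  have eq: "emeasure (density M (\<lambda>x. p x + q x)) B
      = emeasure (density M p) B + emeasure (density M q) B" if "B \<in> sets M" for B
    using that by (simp add: emeasure_density distrib_right nn_integral_add)
  have "sum_meas (density M p) (density M q)
      = measure_of (space M) (sets M) (emeasure (density M (\<lambda>x. p x + q x)))"
    unfolding sum_meas_def space_density sets_density
    by (rule measure_of_eq[OF sets.space_closed])
      (use eq sets.sigma_sets_eq[of M] in auto)
  also have "\<dots> = density M (\<lambda>x. p x + q x)"
    using measure_of_of_measure[of "density M (\<lambda>x. p x + q x)"] by simp
  finally show "emeasure (sum_meas (density M p) (density M q)) A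
      = emeasure (density M (\<lambda>x. p x + q x)) A" by simp
qed

lemma gdiv_eq_formula:
  fixes p q :: "'a \<Rightarrow> real"
  assumes [measurable]: "p \<in> borel_measurable M" "q \<in> borel_measurable M"
    and nonneg: "\<And>x. p x \<ge> 0" "\<And>x. q x \<ge> 0"
    and P: "P = density M (\<lambda>x. ennreal (p x))" "prob_space P"
    and Q: "Q = density M (\<lambda>x. ennreal (q x))" "prob_space Q"
  shows "gdiv g P Q = gdiv_formula g P Q p q"
proof -
  define N where "N = sum_meas P Q"
  have N: "N = density M (\<lambda>x. ennreal (p x) + ennreal (q x))"
    unfolding N_def P(1) Q(1) by (rule sum_meas_density) measurable
  have [simp]: "sets N = sets M" "space N = space M" by (simp_all add: N)
  have fin: "emeasure M' (space M) = 1" if "M' = P \<or> M' = Q" for M'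
    using that P Q prob_space.emeasure_space_1[of P] prob_space.emeasure_space_1[of Q] by auto
  have N1: "finite_measure N"
  proof (rule finite_measureI)
    have "emeasure N (space N) = emeasure P (space M) + emeasure Q (space M)"
      unfolding N P(1) Q(1) by (simp add: emeasure_density distrib_right nn_integral_add)
    then show "emeasure N (space N) \<noteq> \<infinity>" using fin by simp
  qed
  then interpret N: finite_measure N .
  have key: "AE x in M. ennreal (r x)
      = (ennreal (p x) + ennreal (q x)) * RN_deriv N (density M (\<lambda>x. ennreal (r x))) x"
    if [measurable]: "r \<in> borel_measurable M" and r: "\<And>x. r x \<ge> 0" "\<And>x. r x \<le> p x + q x"
      and R: "emeasure (density M (\<lambda>x. ennreal (r x))) (space M) = 1" for r
  proof -
    let ?R = "density M (\<lambda>x. ennreal (r x))"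
    let ?d = "RN_deriv N ?R"
    have ac: "absolutely_continuous N ?R"
    proof (unfold absolutely_continuous_def, rule subsetI)
      fix A assume "A \<in> null_sets N"
      then have A: "A \<in> sets M" "AE x in M. x \<in> A \<longrightarrow> ennreal (p x) + ennreal (q x) = 0"
        unfolding N by (subst (asm) null_sets_density_iff; simp)+
      have "AE x in M. x \<in> A \<longrightarrow> ennreal (r x) = 0"
        using A(2)
      proof eventually_elim
        case (elim x)
        show ?case
        proof
          assume "x \<in> A"
          then have "p x + q x = 0"
            using elim nonneg[of x] by (simp add: ennreal_plus[symmetric] del: ennreal_plus)
          then show "ennreal (r x) = 0" using r(2)[of x] by (simp add: ennreal_neg)
        qed
      qed
      then show "A \<in> null_sets ?R"
        using A(1) by (subst null_sets_density_iff) auto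
    qed
    have dm[measurable]: "?d \<in> borel_measurable M"
      using borel_measurable_RN_deriv[of N ?R] by (simp cong: measurable_cong_sets)
    have "?R = density N ?d" by (rule N.density_RN_deriv[OF ac, symmetric]) simp
    also have "\<dots> = density M (\<lambda>x. (ennreal (p x) + ennreal (q x)) * ?d x)"
      unfolding N by (subst density_density_eq) (auto simp: N[symmetric])
    finally have eq: "?R = density M (\<lambda>x. (ennreal (p x) + ennreal (q x)) * ?d x)" .
    have "(\<integral>\<^sup>+x. ennreal (r x) \<partial>M) = 1"
      using R by (simp add: emeasure_density cong: nn_integral_cong)
    then show ?thesis
      using eq by (subst finite_density_unique[symmetric]) auto
  qed
  define p0 where "p0 x = enn2real (RN_deriv N P x)" for x
  define q0 where "q0 x = enn2real (RN_deriv N Q x)" for x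
  have "AE x in M. p x = (p x + q x) * p0 x" "AE x in M. q x = (p x + q x) * q0 x"
  proof -
    have "AE x in M. ennreal (p x) = (ennreal (p x) + ennreal (q x)) * RN_deriv N P x"
      unfolding P(1) by (rule key) (use nonneg fin[of P] P(1) in auto)
    then show "AE x in M. p x = (p x + q x) * p0 x"
    proof eventually_elim
      case (elim x)
      have "p x = enn2real (ennreal (p x + q x) * RN_deriv N P x)"
        using elim nonneg by (metis enn2real_ennreal ennreal_plus)
      then show ?case using nonneg by (simp add: enn2real_mult p0_def del: ennreal_plus)
    qed
    have "AE x in M. ennreal (q x) = (ennreal (p x) + ennreal (q x)) * RN_deriv N Q x"
      unfolding Q(1) by (rule key) (use nonneg fin[of Q] Q(1) in auto)
    then show "AE x in M. q x = (p x + q x) * q0 x"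
    proof eventually_elim
      case (elim x)
      have "q x = enn2real (ennreal (p x + q x) * RN_deriv N Q x)"
        using elim nonneg by (metis enn2real_ennreal ennreal_plus)
      then show ?case using nonneg by (simp add: enn2real_mult q0_def del: ennreal_plus)
    qed
  qed
  then have main: "AE x in M. (p x > 0 \<or> q x > 0) \<longrightarrow>
      (q0 x > 0 \<longleftrightarrow> q x > 0) \<and> (q0 x = 0 \<longleftrightarrow> q x = 0) \<and> p0 x / q0 x = p x / q x"
  proof eventually_elim
    case (elim x)
    show ?case
    proof
      assume "p x > 0 \<or> q x > 0"
      then have c: "p x + q x > 0" using nonneg[of x] by linarith
      obtain c where c: "c > 0" "p x = c * p0 x" "q x = c * q0 x"
        using c elim by metis
      then show "(q0 x > 0 \<longleftrightarrow> q x > 0) \<and> (q0 x = 0 \<longleftrightarrow> q x = 0) \<and> p0 x / q0 x = p x / q x"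
        by (simp add: zero_less_mult_iff)
    qed
  qed
  have [measurable]: "q0 \<in> borel_measurable M"
    using borel_measurable_RN_deriv[of N Q] unfolding q0_def
    by (simp cong: measurable_cong_sets)
  have AEQ: "AE x in Q. ext_at_zero g (p0 x / q0 x) * indicator {x. q0 x > 0} x
      = ext_at_zero g (p x / q x) * indicator {x. q x > 0} x"
    unfolding Q(1) by (subst AE_density, simp)
      (use main in eventually_elim, auto simp: indicator_def)
  have "AE x in P. q0 x = 0 \<longleftrightarrow> q x = 0"
    unfolding P(1) by (subst AE_density, simp) (use main in eventually_elim, auto)
  then have "emeasure P {x \<in> space P. q0 x = 0} = emeasure P {x \<in> space P. q x = 0}"
    by (intro emeasure_eq_AE) (auto simp: P(1))
  then have "measure P {x \<in> space P. q0 x = 0} = measure P {x \<in> space P. q x = 0}"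
    by (simp add: measure_def)
  moreover have "ereal_integral Q (\<lambda>x. ext_at_zero g (p0 x / q0 x) * indicator {x. q0 x > 0} x)
      = ereal_integral Q (\<lambda>x. ext_at_zero g (p x / q x) * indicator {x. q x > 0} x)"
  proof -
    have "(\<integral>\<^sup>+x. e2ennreal (ext_at_zero g (p0 x / q0 x) * indicator {x. q0 x > 0} x) \<partial>Q)
        = (\<integral>\<^sup>+x. e2ennreal (ext_at_zero g (p x / q x) * indicator {x. q x > 0} x) \<partial>Q)"
      by (rule nn_integral_cong_AE) (use AEQ in eventually_elim, simp)
    moreover
    have "(\<integral>\<^sup>+x. e2ennreal (- (ext_at_zero g (p0 x / q0 x) * indicator {x. q0 x > 0} x)) \<partial>Q)
        = (\<integral>\<^sup>+x. e2ennreal (- (ext_at_zero g (p x / q x) * indicator {x. q x > 0} x)) \<partial>Q)"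
      by (rule nn_integral_cong_AE) (use AEQ in eventually_elim, simp)
    ultimately show ?thesis unfolding ereal_integral_def by simp
  qed
  ultimately have "gdiv_formula g P Q p0 q0 = gdiv_formula g P Q p q"
    unfolding gdiv_formula_def by simp
  then show ?thesis
    unfolding gdiv_def N_def[symmetric] p0_def q0_def .
qed

end

theory Submission
  imports Defs
begin

text \<open>
  The perspective of a convex \<open>f\<close>, extended by \<open>f(0)\<close> and \<open>f'(\<infinity>)\<close> to the boundary of the quadrant,
  is the supremum of the linear forms \<open>a p + b q\<close> over the affine minorants \<open>a t + b\<close> of \<open>f\<close>.
  Hence a divergence constraint is a family of linear inequalities in \<open>(P, Q)\<close>; it is convex, and
  it survives merging of points. The objective is an affine function of \<open>\<integral> \<bar>p - s q\<bar>\<close>, which is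
  unchanged when the space is merged to the two cells \<open>p \<ge> s q\<close> and \<open>p < s q\<close>. So two of the
  \<open>m + 2\<close> atoms already suffice for the upper bound. Conversely, for every set \<open>B\<close>,
  \<open>D(P || Q) \<ge> min 1 s - 1 + P(B) - s Q(B)\<close> with \<open>D\<close> the primitive divergence; on an atomic
  space, with \<open>B\<close> the set of atoms of sign \<open>1\<close>, this is the lower bound.
\<close>

section \<open>Affine minorants and the perspective\<close>

text \<open>Only \<open>t > 0\<close> is tested: the boundary values are limits, recovered below as
  suprema of intercepts (at 0) and of slopes (at infinity).\<close>

definition affine_minorants :: "(real \<Rightarrow> real) \<Rightarrow> (real \<times> real) set" where
  "affine_minorants f = {(a, b). \<forall>t>0. a * t + b \<le> f t}"

lemma supporting_line:
  fixes f :: "real \<Rightarrow> real"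
  assumes "convex_on {0<..} f" "x > 0"
  obtains a where "(a, f x - a * x) \<in> affine_minorants f"
proof -
  \<comment> \<open>By convexity the infimum of the difference quotients to the right of
    \<open>x\<close> is the right derivative at \<open>x\<close>, the slope of a supporting
    line.\<close>
  define a where "a = Inf ((\<lambda>t. (f x - f t) / (x - t)) ` ({x<..} \<inter> {0<..}))"
  have "f x + a * (t - x) \<le> f t" if "t > 0" for t
    unfolding a_def using assms that
    by (intro convex_le_Inf_differential) (auto simp: interior_open)
  then show thesis
    by (intro that[of a]) (auto simp: affine_minorants_def algebra_simps)
qed

lemma affine_minorants_nonempty:
  assumes "convex_on {0<..} f"
  shows "affine_minorants f \<noteq> {}"
  using supporting_line[OF assms, of 1] by auto

text \<open>The normalization at 1 controls the supporting line \<open>a t + b\<close> at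
  \<open>x\<close>: from \<open>a + b \<le> 0\<close> follow \<open>f x \<le> (1 - x) b\<close> and
  \<open>f x \<le> a (x - 1)\<close>, which drive the two limits below.\<close>

lemma minorant_at_one:
  assumes "f 1 = 0" "(a, b) \<in> affine_minorants f"
  shows "a + b \<le> 0"
  using assms by (auto simp: affine_minorants_def dest: spec[of _ 1])

text \<open>Each fixed minorant \<open>a x + b\<close> tends to its intercept, which bounds the
  limit from below. From above, the supporting line at \<open>x\<close> bounds \<open>f x\<close> by
  \<open>1 - x\<close> times the supremum of the intercepts.\<close>

lemma tendsto_at_zero:
  assumes f: "convex_on {0<..} f" "f 1 = 0"
  shows "((\<lambda>x. ereal (f x)) \<longlongrightarrow> (SUP (a, b)\<in>affine_minorants f. ereal b)) (at_right 0)"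
    (is "(_ \<longlongrightarrow> ?S) _")
proof (rule order_tendstoI)
  fix y assume "y < ?S"
  then obtain a b where ab: "(a, b) \<in> affine_minorants f" "y < ereal b"
    by (auto simp: less_SUP_iff)
  have "((\<lambda>x. ereal (a * x + b)) \<longlongrightarrow> ereal (a * 0 + b)) (at_right 0)"
    by (intro tendsto_intros)
  then have "eventually (\<lambda>x. y < ereal (a * x + b)) (at_right 0)"
    using ab(2) by (intro order_tendstoD) auto
  moreover have "eventually (\<lambda>x::real. x > 0) (at_right 0)"
    by (simp add: eventually_at_right_less)
  ultimately show "eventually (\<lambda>x. y < ereal (f x)) (at_right 0)"
  proof eventually_elim
    case (elim x)
    then have "ereal (a * x + b) \<le> ereal (f x)"
      using ab(1) by (auto simp: affine_minorants_def)
    then show ?case using elim by (meson less_le_trans)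
  qed
next
  fix y assume y: "?S < y"
  obtain a0 b0 where "(a0, b0) \<in> affine_minorants f"
    using affine_minorants_nonempty[OF f(1)] by auto
  then have "ereal b0 \<le> ?S" by (auto intro: SUP_upper2)
  then obtain r where r: "?S = ereal r"
    using y by (cases ?S) auto
  have "((\<lambda>x. ereal ((1 - x) * r)) \<longlongrightarrow> ereal ((1 - 0) * r)) (at_right 0)"
    by (intro tendsto_intros)
  then have "eventually (\<lambda>x. ereal ((1 - x) * r) < y) (at_right 0)"
    using y r by (intro order_tendstoD) auto
  moreover have "eventually (\<lambda>x::real. x \<in> {0<..<1}) (at_right 0)"
    by (rule eventually_at_right_real) simp
  ultimately show "eventually (\<lambda>x. ereal (f x) < y) (at_right 0)"
  proof eventually_elim
    case (elim x)
    then obtain a where a: "(a, f x - a * x) \<in> affine_minorants f"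
      using supporting_line[OF f(1), of x] by auto
    then have "ereal (f x - a * x) \<le> ?S" by (intro SUP_upper2[OF a]) auto
    then have b: "f x - a * x \<le> r" unfolding r by simp
    \<comment> \<open>With the intercept \<open>b = f x - a * x\<close>, the value splits as
      \<open>f x = x (a + b) + (1 - x) b\<close>; the first summand is at most 0.\<close>
    have "x * (a + (f x - a * x)) \<le> 0"
      using minorant_at_one[OF f(2) a] elim by (intro mult_nonneg_nonpos) auto
    moreover have "(1 - x) * (f x - a * x) \<le> (1 - x) * r"
      using b elim by (intro mult_left_mono) auto
    ultimately have "f x \<le> (1 - x) * r"
      by (simp add: algebra_simps)
    then have "ereal (f x) \<le> ereal ((1 - x) * r)" by simp
    also have "\<dots> < y" using elim by simp
    finally show ?case .
  qed
qed

text \<open>The same argument with slopes in place of intercepts; here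
  \<open>f x = a (x - 1) + (a + b)\<close> for the supporting line at \<open>x\<close>, and
  \<open>a + b \<le> 0\<close>.\<close>

lemma tendsto_at_infinity:
  assumes f: "convex_on {0<..} f" "f 1 = 0"
  shows "((\<lambda>x. ereal (f x / x)) \<longlongrightarrow> (SUP (a, b)\<in>affine_minorants f. ereal a)) at_top"
    (is "(_ \<longlongrightarrow> ?S) _")
proof (rule order_tendstoI)
  fix y assume "y < ?S"
  then obtain a b where ab: "(a, b) \<in> affine_minorants f" "y < ereal a"
    by (auto simp: less_SUP_iff)
  have "((\<lambda>x. a + b * inverse x) \<longlongrightarrow> a + b * 0) at_top"
    by (intro tendsto_intros tendsto_inverse_0_at_top filterlim_ident)
  then have "((\<lambda>x. ereal (a + b * inverse x)) \<longlongrightarrow> ereal a) at_top"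
    by (intro tendsto_intros) simp
  then have "eventually (\<lambda>x. y < ereal (a + b * inverse x)) at_top"
    using ab(2) by (intro order_tendstoD) auto
  then show "eventually (\<lambda>x. y < ereal (f x / x)) at_top"
    using eventually_gt_at_top[of 0]
  proof eventually_elim
    case (elim x)
    then have "(a * x + b) / x \<le> f x / x"
      using ab(1) by (intro divide_right_mono) (auto simp: affine_minorants_def)
    then have "ereal (a + b * inverse x) \<le> ereal (f x / x)"
      using elim by (simp add: add_divide_distrib) (simp add: divide_inverse)
    then show ?case using elim by (meson less_le_trans)
  qed
next
  fix y assume y: "?S < y"
  obtain a0 b0 where "(a0, b0) \<in> affine_minorants f"
    using affine_minorants_nonempty[OF f(1)] by auto
  then have "ereal a0 \<le> ?S" by (auto intro: SUP_upper2)
  then obtain r where r: "?S = ereal r"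
    using y by (cases ?S) auto
  have "((\<lambda>x. (1 - inverse x) * r) \<longlongrightarrow> (1 - 0) * r) at_top"
    by (intro tendsto_intros tendsto_inverse_0_at_top filterlim_ident)
  then have "((\<lambda>x. ereal ((1 - inverse x) * r)) \<longlongrightarrow> ereal r) at_top"
    by (intro tendsto_intros) simp
  then have "eventually (\<lambda>x. ereal ((1 - inverse x) * r) < y) at_top"
    using y r by (intro order_tendstoD) auto
  then show "eventually (\<lambda>x. ereal (f x / x) < y) at_top"
    using eventually_gt_at_top[of 1]
  proof eventually_elim
    case (elim x)
    then obtain a where a: "(a, f x - a * x) \<in> affine_minorants f"
      using supporting_line[OF f(1), of x] by auto
    then have "ereal a \<le> ?S" by (intro SUP_upper2[OF a]) auto
    then have b: "a \<le> r" unfolding r by simp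
    have "f x \<le> a * (x - 1)"
      using minorant_at_one[OF f(2) a] by (simp add: algebra_simps)
    also have "\<dots> \<le> r * (x - 1)" using b elim by (intro mult_right_mono) auto
    finally have "f x / x \<le> (1 - inverse x) * r"
      using elim by (simp add: field_simps)
    then have "ereal (f x / x) \<le> ereal ((1 - inverse x) * r)" by simp
    also have "\<dots> < y" using elim by simp
    finally show ?case .
  qed
qed

lemma slope_at_inf_eq_SUP:
  assumes "convex_on {0<..} f" "f 1 = 0"
  shows "slope_at_inf f = (SUP (a, b)\<in>affine_minorants f. ereal a)"
  unfolding slope_at_inf_def
  by (rule tendsto_Lim[OF _ tendsto_at_infinity[OF assms]]) simp

lemma ext_at_zero_eq_SUP:
  assumes "convex_on {0<..} f" "f 1 = 0" "t \<ge> 0"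
  shows "ext_at_zero f t = (SUP (a, b)\<in>affine_minorants f. ereal (a * t + b))"
proof (cases "t = 0")
  case True
  then show ?thesis
    using tendsto_Lim[OF _ tendsto_at_zero[OF assms(1,2)]] by (simp add: ext_at_zero_def)
next
  case False
  then have t: "t > 0" using assms by simp
  obtain a where a: "(a, f t - a * t) \<in> affine_minorants f"
    using supporting_line[OF assms(1) t] .
  have "(SUP (a, b)\<in>affine_minorants f. ereal (a * t + b)) = ereal (f t)"
  proof (rule antisym)
    show "(SUP (a, b)\<in>affine_minorants f. ereal (a * t + b)) \<le> ereal (f t)"
      using t by (auto intro!: SUP_least simp: affine_minorants_def)
    show "ereal (f t) \<le> (SUP (a, b)\<in>affine_minorants f. ereal (a * t + b))"
      by (rule SUP_upper2[OF a]) simp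
  qed
  then show ?thesis using t by (simp add: ext_at_zero_def)
qed

lemma minorant_le_slope_at_inf:
  assumes "convex_on {0<..} f" "f 1 = 0" "(a, b) \<in> affine_minorants f"
  shows "ereal a \<le> slope_at_inf f"
  unfolding slope_at_inf_eq_SUP[OF assms(1,2)] by (rule SUP_upper2[OF assms(3)]) simp

lemma minorant_le_ext_at_zero:
  assumes "convex_on {0<..} f" "f 1 = 0" "(a, b) \<in> affine_minorants f" "t \<ge> 0"
  shows "ereal (a * t + b) \<le> ext_at_zero f t"
  unfolding ext_at_zero_eq_SUP[OF assms(1,2,4)] by (rule SUP_upper2[OF assms(3)]) simp

text \<open>The regular and the singular term of a divergence become one function of a pair of
  masses, so a constraint is a single sum over the atoms.\<close>

definition perspective :: "(real \<Rightarrow> real) \<Rightarrow> real \<Rightarrow> real \<Rightarrow> ereal" where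
  "perspective f p q =
     (if q > 0 then ereal q * ext_at_zero f (p / q) else slope_at_inf f * ereal p)"

text \<open>A nonnegative factor commutes with the supremum. Scaling the formula for
  \<open>ext_at_zero\<close> by \<open>q\<close>, or the one for the slope by \<open>p\<close> when
  \<open>q = 0\<close>, gives the same family of linear forms; at \<open>p = q = 0\<close> both
  sides are 0 even for an infinite slope.\<close>

lemma perspective_eq_SUP:
  assumes f: "convex_on {0<..} f" "f 1 = 0" and "p \<ge> 0" "q \<ge> 0"
  shows "perspective f p q = (SUP (a, b)\<in>affine_minorants f. ereal (a * p + b * q))"
proof -
  have ne: "affine_minorants f \<noteq> {}" by (rule affine_minorants_nonempty[OF f(1)])
  have scale: "ereal c * (SUP x\<in>affine_minorants f. ereal (g x))
      = (SUP x\<in>affine_minorants f. ereal (c * g x))" if "c \<ge> 0" for c g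
    using ne that Sup_ereal_mult_left'[of "affine_minorants f" c "\<lambda>x. ereal (g x)"] by simp
  show ?thesis
  proof (cases "q > 0")
    case True
    then show ?thesis
      using assms scale[of q "\<lambda>(a, b). a * (p / q) + b"]
      by (simp add: perspective_def ext_at_zero_eq_SUP case_prod_unfold algebra_simps)
  next
    case False
    then show ?thesis
      using assms scale[of p "\<lambda>(a, b). a"]
      by (simp add: perspective_def slope_at_inf_eq_SUP case_prod_unfold mult.commute)
  qed
qed

lemma minorant_le_perspective:
  assumes "convex_on {0<..} f" "f 1 = 0" "p \<ge> 0" "q \<ge> 0" "(a, b) \<in> affine_minorants f"
  shows "ereal (a * p + b * q) \<le> perspective f p q"
  unfolding perspective_eq_SUP[OF assms(1-4)] by (rule SUP_upper2[OF assms(5)]) simp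

lemma perspective_not_MInfty:
  assumes "convex_on {0<..} f" "f 1 = 0" "p \<ge> 0" "q \<ge> 0"
  shows "perspective f p q \<noteq> -\<infinity>"
proof -
  obtain a b where "(a, b) \<in> affine_minorants f"
    using affine_minorants_nonempty[OF assms(1)] by auto
  from minorant_le_perspective[OF assms this] show ?thesis by auto
qed

section \<open>Sums of perspectives as suprema of linear forms\<close>

lemma sum_not_MInfty:
  fixes g :: "'a \<Rightarrow> ereal"
  assumes "\<And>j. j \<in> J \<Longrightarrow> g j \<noteq> -\<infinity>"
  shows "sum g J \<noteq> -\<infinity>"
  using assms by (induction J rule: infinite_finite_induct) auto

text \<open>The constant \<open>c\<close> absorbs the linear forms already chosen in the induction over \<open>J\<close>.\<close>

lemma add_sum_perspective_le:
  assumes f: "convex_on {0<..} f" "f 1 = 0"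
    and "finite J" "\<And>j. j \<in> J \<Longrightarrow> p j \<ge> 0" "\<And>j. j \<in> J \<Longrightarrow> q j \<ge> 0"
    and "\<And>a b. \<forall>j\<in>J. (a j, b j) \<in> affine_minorants f \<Longrightarrow>
           ereal (c + (\<Sum>j\<in>J. a j * p j + b j * q j)) \<le> X"
  shows "ereal c + (\<Sum>j\<in>J. perspective f (p j) (q j)) \<le> X"
  using assms(3-)
proof (induction J arbitrary: c rule: finite_induct)
  case empty
  show ?case using empty.prems(3)[of "\<lambda>_. 0" "\<lambda>_. 0"] by simp
next
  case (insert j J)
  let ?S = "\<Sum>i\<in>J. perspective f (p i) (q i)"
  have S: "?S \<noteq> -\<infinity>"
    using insert.prems(1,2) by (intro sum_not_MInfty perspective_not_MInfty[OF f]) auto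
  have le: "ereal (a * p j + b * q j) + (ereal c + ?S) \<le> X"
    if ab: "(a, b) \<in> affine_minorants f" for a b
  proof -
    have "ereal (c + (a * p j + b * q j)) + ?S \<le> X"
    proof (rule insert.IH)
      fix a' b' assume "\<forall>i\<in>J. (a' i, b' i) \<in> affine_minorants f"
      then have "ereal (c + (\<Sum>i\<in>insert j J. (a'(j := a)) i * p i + (b'(j := b)) i * q i)) \<le> X"
        using ab insert.hyps by (intro insert.prems(3)) auto
      also have "(\<Sum>i\<in>insert j J. (a'(j := a)) i * p i + (b'(j := b)) i * q i)
          = a * p j + b * q j + (\<Sum>i\<in>J. a' i * p i + b' i * q i)"
        using insert.hyps by (subst sum.insert) (auto intro!: sum.cong)
      finally show "ereal (c + (a * p j + b * q j) + (\<Sum>i\<in>J. a' i * p i + b' i * q i)) \<le> X"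
        by (simp add: add.assoc)
    qed (use insert.prems(1,2) in auto)
    then show ?thesis by (cases ?S) (simp_all add: add_ac)
  qed
  have "ereal c + (perspective f (p j) (q j) + ?S)
      = (SUP (a, b)\<in>affine_minorants f. ereal (a * p j + b * q j)) + (ereal c + ?S)"
    using insert.prems(1,2)
    by (subst perspective_eq_SUP[OF f]) (simp_all add: add.left_commute)
  \<comment> \<open>The supremum moves out of the sum because the remaining summand is not
    \<open>-\<infinity>\<close>.\<close>
  also have "\<dots> = (SUP (a, b)\<in>affine_minorants f. ereal (a * p j + b * q j) + (ereal c + ?S))"
    unfolding case_prod_unfold using S
    by (intro SUP_ereal_add_left[symmetric] affine_minorants_nonempty[OF f(1)]) simp
  also have "\<dots> \<le> X" using le by (auto intro: SUP_least)
  finally show ?case using insert.hyps by simp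
qed

text \<open>A sum of suprema is the supremum over independent choices of a minorant at each
  index.\<close>

lemma sum_perspective_le_iff:
  assumes f: "convex_on {0<..} f" "f 1 = 0"
    and "finite J" "\<And>j. j \<in> J \<Longrightarrow> p j \<ge> 0" "\<And>j. j \<in> J \<Longrightarrow> q j \<ge> 0"
  shows "(\<Sum>j\<in>J. perspective f (p j) (q j)) \<le> X \<longleftrightarrow>
    (\<forall>a b. (\<forall>j\<in>J. (a j, b j) \<in> affine_minorants f) \<longrightarrow>
       ereal (\<Sum>j\<in>J. a j * p j + b j * q j) \<le> X)"
proof (intro iffI allI impI)
  fix a b
  assume X: "(\<Sum>j\<in>J. perspective f (p j) (q j)) \<le> X"
    and ab: "\<forall>j\<in>J. (a j, b j) \<in> affine_minorants f"
  have "ereal (\<Sum>j\<in>J. a j * p j + b j * q j) = (\<Sum>j\<in>J. ereal (a j * p j + b j * q j))"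
    by simp
  also have "\<dots> \<le> (\<Sum>j\<in>J. perspective f (p j) (q j))"
    using assms ab by (intro sum_mono minorant_le_perspective) auto
  finally show "ereal (\<Sum>j\<in>J. a j * p j + b j * q j) \<le> X" using X by simp
next
  assume "\<forall>a b. (\<forall>j\<in>J. (a j, b j) \<in> affine_minorants f) \<longrightarrow>
       ereal (\<Sum>j\<in>J. a j * p j + b j * q j) \<le> X"
  then have "ereal 0 + (\<Sum>j\<in>J. perspective f (p j) (q j)) \<le> X"
    using assms by (intro add_sum_perspective_le) auto
  then show "(\<Sum>j\<in>J. perspective f (p j) (q j)) \<le> X"
    by (simp flip: zero_ereal_def)
qed

text \<open>The left-hand side is the form of the constraint in \<open>feasible\<close>. A possibly
  infinite slope distributes over the sum because all \<open>p j\<close> are nonnegative.\<close>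

lemma sum_perspective:
  assumes "finite J" "\<And>j. j \<in> J \<Longrightarrow> p j \<ge> 0" "\<And>j. j \<in> J \<Longrightarrow> q j \<ge> 0"
  shows "(\<Sum>j\<in>{j \<in> J. q j > 0}. ereal (q j) * ext_at_zero f (p j / q j))
        + slope_at_inf f * ereal (\<Sum>j\<in>{j \<in> J. q j = 0}. p j)
      = (\<Sum>j\<in>J. perspective f (p j) (q j))"
proof -
  have "slope_at_inf f * ereal (\<Sum>j\<in>{j \<in> J. q j = 0}. p j)
      = (\<Sum>j\<in>{j \<in> J. q j = 0}. slope_at_inf f * ereal (p j))"
    unfolding sum_ereal[symmetric] using assms by (intro sum_ereal_right_distrib) auto
  moreover have "J \<inter> - {j. q j > 0} = {j \<in> J. q j = 0}" "J \<inter> {j. q j > 0} = {j \<in> J. q j > 0}"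
    using assms(3) by (auto simp: order.order_iff_strict)
  ultimately show ?thesis
    using assms(1) by (simp add: perspective_def sum.If_cases)
qed

text \<open>In this form every constraint is linear in \<open>(p, q)\<close>; both the convexity of
  the problems and the merging of points rest on it.\<close>

lemma feasible_iff:
  assumes fs: "\<forall>i\<in>{1..m}. convex_on {0<..} (fs i) \<and> fs i 1 = 0"
  shows "feasible m fs D p q \<longleftrightarrow>
     (\<forall>j\<in>{1..m + 2}. p j \<in> {0..1} \<and> q j \<in> {0..1}) \<and>
     (\<Sum>j=1..m + 2. p j) = 1 \<and> (\<Sum>j=1..m + 2. q j) = 1 \<and>
     (\<forall>i\<in>{1..m}. \<forall>a b. (\<forall>j\<in>{1..m + 2}. (a j, b j) \<in> affine_minorants (fs i)) \<longrightarrow>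
        (\<Sum>j=1..m + 2. a j * p j + b j * q j) \<le> D i)"
proof -
  have "(\<Sum>j\<in>{j \<in> {1..m + 2}. q j > 0}. ereal (q j) * ext_at_zero (fs i) (p j / q j))
        + slope_at_inf (fs i) * ereal (\<Sum>j\<in>{j \<in> {1..m + 2}. q j = 0}. p j) \<le> ereal (D i) \<longleftrightarrow>
      (\<forall>a b. (\<forall>j\<in>{1..m + 2}. (a j, b j) \<in> affine_minorants (fs i)) \<longrightarrow>
        (\<Sum>j=1..m + 2. a j * p j + b j * q j) \<le> D i)" (is "?l i \<le> _ \<longleftrightarrow> ?r i")
    if i: "i \<in> {1..m}" and pq: "\<forall>j\<in>{1..m + 2}. p j \<in> {0..1} \<and> q j \<in> {0..1}" for i
  proof -
    have nonneg: "p j \<ge> 0" "q j \<ge> 0" if "j \<in> {1..m + 2}" for j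
      using bspec[OF pq that] by auto
    have "?l i = (\<Sum>j\<in>{1..m + 2}. perspective (fs i) (p j) (q j))"
      using nonneg by (intro sum_perspective) blast+
    then show ?thesis
      using sum_perspective_le_iff[of "fs i" "{1..m + 2}" p q "ereal (D i)"] nonneg bspec[OF fs i]
      by (simp only: ereal_less_eq finite_atLeastAtMost simp_thms)
  qed
  note * = this
  show ?thesis
  \<comment> \<open>The reformulation \<open>*\<close> relies on nonnegative masses; if the range
    condition fails, both sides are false.\<close>
  proof (cases "\<forall>j\<in>{1..m + 2}. p j \<in> {0..1} \<and> q j \<in> {0..1}")
    case True
    then have "(\<forall>i\<in>{1..m}. ?l i \<le> ereal (D i)) \<longleftrightarrow> (\<forall>i\<in>{1..m}. ?r i)"
      by (intro ball_cong refl *)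
    then show ?thesis unfolding feasible_def by (simp only:)
  next
    case False
    then show ?thesis unfolding feasible_def by (simp only: simp_thms)
  qed
qed

text \<open>By \<open>feasible_iff\<close> the feasible set is cut out by linear equations and
  inequalities. As the objective is linear, this makes the problems convex.\<close>

lemma feasible_convex_combination:
  assumes fs: "\<forall>i\<in>{1..m}. convex_on {0<..} (fs i) \<and> fs i 1 = 0"
    and pq: "feasible m fs D p q" "feasible m fs D p' q'" and t: "0 \<le> t" "t \<le> (1::real)"
  shows "feasible m fs D (\<lambda>j. (1 - t) * p j + t * p' j) (\<lambda>j. (1 - t) * q j + t * q' j)"
    (is "feasible m fs D ?p ?q")
proof -
  note iff = feasible_iff[OF fs]
  have comb: "(1 - t) * x + t * y \<le> z" if "x \<le> z" "y \<le> z" for x y z :: real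
    using convex_bound_le[of x z y "1 - t" t] that t by simp
  have lin: "(\<Sum>j=1..m + 2. a j * ?p j + b j * ?q j)
      = (1 - t) * (\<Sum>j=1..m + 2. a j * p j + b j * q j)
        + t * (\<Sum>j=1..m + 2. a j * p' j + b j * q' j)" for a b :: "nat \<Rightarrow> real"
    by (simp only: sum_distrib_left sum.distrib[symmetric]) (simp add: algebra_simps)
  have "?p j \<in> {0..1} \<and> ?q j \<in> {0..1}" if "j \<in> {1..m + 2}" for j
  proof -
    have "p j \<in> {0..1}" "p' j \<in> {0..1}" "q j \<in> {0..1}" "q' j \<in> {0..1}"
      using pq that unfolding iff by blast+
    then show ?thesis using t comb by auto
  qed
  moreover have "(\<Sum>j=1..m + 2. ?p j) = 1" "(\<Sum>j=1..m + 2. ?q j) = 1"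
    using pq unfolding iff sum.distrib sum_distrib_left[symmetric] by simp_all
  moreover have "(\<Sum>j=1..m + 2. a j * ?p j + b j * ?q j) \<le> D i"
    if "i \<in> {1..m}" "\<forall>j\<in>{1..m + 2}. (a j, b j) \<in> affine_minorants (fs i)" for i a b
    unfolding lin using pq that unfolding iff by (intro comb) blast+
  ultimately show ?thesis unfolding iff by blast
qed

section \<open>Integrals of extended real functions\<close>

lemma ereal_integral_real:
  assumes "integrable M L"
  shows "ereal_integral M (\<lambda>x. ereal (L x)) = ereal (integral\<^sup>L M L)"
proof -
  have "(\<integral>\<^sup>+x. ennreal (L x) \<partial>M) < \<infinity>" "(\<integral>\<^sup>+x. ennreal (- L x) \<partial>M) < \<infinity>"
    using assms by (auto simp: real_integrable_def less_top)
  then show ?thesis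
    unfolding ereal_integral_def real_lebesgue_integral_def[OF assms]
    by (cases "\<integral>\<^sup>+x. ennreal (L x) \<partial>M"; cases "\<integral>\<^sup>+x. ennreal (- L x) \<partial>M")
      (auto simp: e2ennreal_ereal)
qed

text \<open>The positive part grows and the negative part shrinks. Nonnegative integrals are
  monotone for arbitrary functions, so \<open>gdiv_ge\<close> can compare with the divergence
  integrand without discussing its measurability.\<close>

lemma ereal_integral_mono:
  assumes "\<And>x. x \<in> space M \<Longrightarrow> g x \<le> h x"
  shows "ereal_integral M g \<le> ereal_integral M h"
  unfolding ereal_integral_def
  using assms
  by (intro ereal_minus_mono iffD1[OF less_eq_ennreal.rep_eq] nn_integral_mono e2ennreal_mono)
     auto

section \<open>Divergences of a pair with densities\<close>

text \<open>Arbitrary densities replace the Radon-Nikodym derivatives in \<open>gdiv\<close>, by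
  \<open>gdiv_eq\<close>. The instances are \<open>N = P + Q\<close> for the upper bound and
  counting measure for atomic measures.\<close>

locale density_pair =
  fixes N P Q :: "'a measure" and p q :: "'a \<Rightarrow> real"
  assumes measurable_densities [measurable]: "p \<in> borel_measurable N" "q \<in> borel_measurable N"
    and nonneg: "\<And>x. p x \<ge> 0" "\<And>x. q x \<ge> 0"
    and P_eq: "P = density N (\<lambda>x. ennreal (p x))"
    and Q_eq: "Q = density N (\<lambda>x. ennreal (q x))"
    and prob_space_P: "prob_space P" and prob_space_Q: "prob_space Q"
begin

sublocale P: prob_space P by (rule prob_space_P)
sublocale Q: prob_space Q by (rule prob_space_Q)

lemma sets_P [simp, measurable_cong]: "sets P = sets N" and sets_Q [simp, measurable_cong]: "sets Q = sets N"
  and space_P [simp]: "space P = space N" and space_Q [simp]: "space Q = space N"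
  by (simp_all add: P_eq Q_eq)

lemma gdiv_eq: "gdiv g P Q = gdiv_formula g P Q p q"
  by (rule gdiv_eq_formula[OF measurable_densities nonneg P_eq prob_space_P Q_eq prob_space_Q])

text \<open>Change of measure: \<open>p / q\<close> is the density with respect to \<open>Q\<close>
  of the absolutely continuous part of \<open>P\<close> only, which is why \<alpha> is cut off on
  \<open>{q = 0}\<close>.\<close>

lemma integral_ratio:
  assumes "integrable P \<alpha>" "integrable Q \<beta>"
  defines "L \<equiv> \<lambda>x. if q x > 0 then \<alpha> x * (p x / q x) + \<beta> x else 0"
  shows "integrable Q L"
    and "integral\<^sup>L Q L = (\<integral>x. (if q x > 0 then \<alpha> x else 0) \<partial>P) + integral\<^sup>L Q \<beta>"
proof -
  have [measurable]: "\<alpha> \<in> borel_measurable N" "\<beta> \<in> borel_measurable N"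
    using assms(1,2)[THEN borel_measurable_integrable] by simp_all
  have [measurable]: "L \<in> borel_measurable N" unfolding L_def by measurable
  let ?\<alpha> = "\<lambda>x. if q x > 0 then \<alpha> x else 0"
  have eq: "q x * L x = p x * ?\<alpha> x + q x * \<beta> x" for x
    using nonneg[of x] by (auto simp: L_def field_simps)
  have \<alpha>: "integrable P ?\<alpha>"
    by (rule Bochner_Integration.integrable_bound[OF assms(1)]) auto
  then have ints: "integrable N (\<lambda>x. p x * ?\<alpha> x)" "integrable N (\<lambda>x. q x * \<beta> x)"
    using assms(2) nonneg by (simp_all add: P_eq Q_eq integrable_density)
  show "integrable Q L"
    using nonneg Bochner_Integration.integrable_add[OF ints]
    by (simp add: Q_eq integrable_density eq)
  show "integral\<^sup>L Q L = integral\<^sup>L P ?\<alpha> + integral\<^sup>L Q \<beta>"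
    using nonneg Bochner_Integration.integral_add[OF ints]
    by (simp add: Q_eq P_eq integral_density eq)
qed

text \<open>The integral version of \<open>minorant_le_perspective\<close>, with a minorant that may
  vary from point to point. On \<open>{q > 0}\<close> the minorant lies below the integrand; on
  \<open>{q = 0}\<close> its slope lies below the slope at infinity.\<close>

lemma gdiv_ge:
  assumes f: "convex_on {0<..} f" "f 1 = 0"
    and int: "integrable P \<alpha>" "integrable Q \<beta>"
    and mem: "\<And>x. (\<alpha> x, \<beta> x) \<in> affine_minorants f"
  shows "ereal (integral\<^sup>L P \<alpha> + integral\<^sup>L Q \<beta>) \<le> gdiv f P Q"
proof -
  have [measurable]: "\<alpha> \<in> borel_measurable N"
    using int(1)[THEN borel_measurable_integrable] by simp
  let ?L = "\<lambda>x. if q x > 0 then \<alpha> x * (p x / q x) + \<beta> x else 0"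
  let ?pos = "\<lambda>x. if q x > 0 then \<alpha> x else 0" and ?null = "\<lambda>x. if q x = 0 then \<alpha> x else 0"
  let ?Z = "{x \<in> space P. q x = 0}"
  have ints: "integrable P ?pos" "integrable P ?null"
    by (rule Bochner_Integration.integrable_bound[OF int(1)]; auto)+
  have "ereal (integral\<^sup>L Q ?L)
      = ereal_integral Q (\<lambda>x. ereal (?L x))"
    by (rule ereal_integral_real[symmetric, OF integral_ratio(1)[OF int]])
  also have "\<dots> \<le> ereal_integral Q (\<lambda>x. ext_at_zero f (p x / q x) * indicator {x. q x > 0} x)"
    using minorant_le_ext_at_zero[OF f mem, of "p x / q x" x for x] nonneg
    by (intro ereal_integral_mono) (auto simp: indicator_def)
  finally have abs_cont: "ereal (integral\<^sup>L Q ?L) \<le>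
      ereal_integral Q (\<lambda>x. ext_at_zero f (p x / q x) * indicator {x. q x > 0} x)" .
  have slope: "ereal (\<alpha> x) \<le> slope_at_inf f" for x
    by (rule minorant_le_slope_at_inf[OF f mem])
  have sing: "ereal (integral\<^sup>L P ?null) \<le> slope_at_inf f * ereal (measure P ?Z)"
  \<comment> \<open>The slope may be infinite. On a null set both sides are 0 since
    \<open>\<infinity> * 0 = 0\<close>; with positive mass and infinite slope the right-hand side is
    infinite.\<close>
  proof (cases "measure P ?Z = 0")
    case True
    then have "AE x in P. x \<notin> ?Z"
      by (intro AE_not_in) (auto simp: null_sets_def P.emeasure_eq_measure)
    then have "AE x in P. ?null x = 0" using AE_space by eventually_elim auto
    then have "integral\<^sup>L P ?null = 0" by (rule integral_eq_zero_AE)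
    then show ?thesis using True by (simp flip: zero_ereal_def)
  next
    case False
    then have pos: "measure P ?Z > 0" by (simp add: zero_less_measure_iff)
    show ?thesis
    proof (cases "slope_at_inf f")
      case (real r)
      have "integrable P (\<lambda>x. r * indicator ?Z x)"
        by (intro integrable_mult_right integrable_real_indicator)
          (auto simp: P.emeasure_eq_measure)
      then have "integral\<^sup>L P ?null \<le> (\<integral>x. r * indicator ?Z x \<partial>P)"
        using ints(2) slope real by (intro integral_mono) (auto simp: indicator_def)
      then show ?thesis using real by simp
    qed (use pos slope in auto)
  qed
  have "integral\<^sup>L P \<alpha> = (\<integral>x. ?pos x + ?null x \<partial>P)"
    using nonneg by (intro Bochner_Integration.integral_cong) (auto simp: order.order_iff_strict)
  also have "\<dots> = integral\<^sup>L P ?pos + integral\<^sup>L P ?null"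
    using ints by (rule Bochner_Integration.integral_add)
  finally have "ereal (integral\<^sup>L P \<alpha> + integral\<^sup>L Q \<beta>)
      = ereal (integral\<^sup>L Q ?L) + ereal (integral\<^sup>L P ?null)"
    by (simp add: integral_ratio(2)[OF int])
  also have "\<dots> \<le> gdiv f P Q"
    unfolding gdiv_eq gdiv_formula_def using abs_cont sing by (rule add_mono)
  finally show ?thesis .
qed

text \<open>The function \<open>u_prim s\<close> is bounded on the nonnegative reals, extends
  continuously to 0 and is constant from \<open>s\<close> on. Hence its slope at infinity is 0 and
  the divergence is a finite integral without singular part.\<close>

lemma
  assumes "s > 0"
  defines "U \<equiv> \<lambda>x. if q x > 0 then u_prim s (p x / q x) else 0"
  shows integrable_u_prim: "integrable Q U"
    and gdiv_u_prim: "gdiv (u_prim s) P Q = ereal (integral\<^sup>L Q U)"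
proof -
  have "((\<lambda>x. ereal (u_prim s x)) \<longlongrightarrow> ereal (min 1 s - min 0 s)) (at_right 0)"
    unfolding u_prim_def by (intro tendsto_intros)
  then have zero: "Lim (at_right 0) (\<lambda>x. ereal (u_prim s x)) = ereal (u_prim s 0)"
    by (intro tendsto_Lim) (simp_all add: u_prim_def)
  have "((\<lambda>x. (min 1 s - s) * inverse x) \<longlongrightarrow> (min 1 s - s) * 0) at_top"
    by (intro tendsto_intros tendsto_inverse_0_at_top filterlim_ident)
  then have "((\<lambda>x. ereal ((min 1 s - s) * inverse x)) \<longlongrightarrow> 0) at_top"
    by (simp add: zero_ereal_def)
  then have "((\<lambda>x. ereal (u_prim s x / x)) \<longlongrightarrow> 0) at_top"
  proof (rule Lim_transform_eventually)
    show "eventually (\<lambda>x. ereal ((min 1 s - s) * inverse x) = ereal (u_prim s x / x)) at_top"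
      using eventually_ge_at_top[of s] by eventually_elim (simp add: u_prim_def divide_inverse)
  qed
  then have inf: "slope_at_inf (u_prim s) = 0"
    unfolding slope_at_inf_def by (intro tendsto_Lim) simp_all
  have ext: "ext_at_zero (u_prim s) t = ereal (u_prim s t)" if "t \<ge> 0" for t
    using that zero by (auto simp: ext_at_zero_def order.order_iff_strict)
  show U: "integrable Q U"
  proof (rule Q.integrable_const_bound[of _ "1 + s"])
    have "\<bar>u_prim s t\<bar> \<le> 1 + s" if "t \<ge> 0" for t
      using that assms(1) by (auto simp: u_prim_def)
    then show "AE x in Q. norm (U x) \<le> 1 + s"
      using assms(1) nonneg by (auto simp: U_def)
    show "U \<in> borel_measurable Q"
      unfolding U_def u_prim_def by measurable
  qed
  have "(\<lambda>x. ext_at_zero (u_prim s) (p x / q x) * indicator {x. q x > 0} x) = (\<lambda>x. ereal (U x))"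
    using nonneg by (auto simp: U_def ext fun_eq_iff zero_ereal_def)
  then show "gdiv (u_prim s) P Q = ereal (integral\<^sup>L Q U)"
    unfolding gdiv_eq gdiv_formula_def by (simp add: inf ereal_integral_real[OF U])
qed

text \<open>As a function of \<open>t\<close>, \<open>u_prim s t\<close> is the maximum of the two
  affine pieces \<open>min 1 s - t\<close> and \<open>min 1 s - s\<close>; the pair \<alpha>,
  \<beta> selects the constant piece on \<open>B\<close> and the other piece off
  \<open>B\<close>.\<close>

lemma integral_u_prim_minorant:
  fixes s :: real
  assumes "B \<in> sets N"
  defines "\<alpha> \<equiv> \<lambda>x. indicator B x - 1 :: real" and "\<beta> \<equiv> \<lambda>x. min 1 s - s * indicator B x"
  shows "integrable P \<alpha>" "integrable Q \<beta>"
    and "integral\<^sup>L P \<alpha> + integral\<^sup>L Q \<beta> = min 1 s - 1 + measure P B - s * measure Q B"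
proof -
  have P: "integrable P (indicator B :: _ \<Rightarrow> real)" and Q: "integrable Q (\<lambda>x. s * indicator B x :: real)"
    using assms(1) by (auto simp: P.emeasure_eq_measure Q.emeasure_eq_measure)
  show "integrable P \<alpha>" "integrable Q \<beta>"
    unfolding \<alpha>_def \<beta>_def using P Q by auto
  show "integral\<^sup>L P \<alpha> + integral\<^sup>L Q \<beta> = min 1 s - 1 + measure P B - s * measure Q B"
    using P Q assms(1) by (simp add: \<alpha>_def \<beta>_def P.prob_space[simplified] Q.prob_space[simplified])
qed

lemma gdiv_u_prim_ge:
  assumes "s > 0" and B: "B \<in> sets N"
  shows "ereal (min 1 s - 1 + measure P B - s * measure Q B) \<le> gdiv (u_prim s) P Q"
proof -
  let ?\<alpha> = "\<lambda>x. indicator B x - 1 :: real" and ?\<beta> = "\<lambda>x. min 1 s - s * indicator B x"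
  note int = integral_u_prim_minorant(1,2)[OF B] and eq = integral_u_prim_minorant(3)[OF B]
  \<comment> \<open>Since \<alpha> is at most 0, cutting it off on \<open>{q = 0}\<close> can only
    raise the integral.\<close>
  have "integral\<^sup>L P ?\<alpha> \<le> (\<integral>x. (if q x > 0 then ?\<alpha> x else 0) \<partial>P)"
    using int(1) B by (intro integral_mono Bochner_Integration.integrable_bound[OF int(1)])
      (auto simp: indicator_def)
  moreover have "(\<integral>x. (if q x > 0 then ?\<alpha> x * (p x / q x) + ?\<beta> x else 0) \<partial>Q)
      \<le> (\<integral>x. (if q x > 0 then u_prim s (p x / q x) else 0) \<partial>Q)"
    using integrable_u_prim[OF assms(1)] integral_ratio(1)[OF int]
    by (intro integral_mono) (auto simp: u_prim_def indicator_def)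
  ultimately show ?thesis
    unfolding gdiv_u_prim[OF assms(1)] eq[symmetric] integral_ratio(2)[OF int] by simp
qed

text \<open>This \<open>B\<close> selects the larger affine piece at every point, so both
  inequalities behind \<open>gdiv_u_prim_ge\<close> become equalities. Written without division, the
  condition puts all of \<open>{q = 0}\<close> into \<open>B\<close>, where \<alpha> vanishes and
  the cutoff loses nothing.\<close>

lemma gdiv_u_prim_eq:
  assumes "s > 0"
  defines "B \<equiv> {x \<in> space N. s * q x \<le> p x}"
  shows "gdiv (u_prim s) P Q = ereal (min 1 s - 1 + measure P B - s * measure Q B)"
proof -
  have B: "B \<in> sets N" unfolding B_def by measurable
  let ?\<alpha> = "\<lambda>x. indicator B x - 1 :: real" and ?\<beta> = "\<lambda>x. min 1 s - s * indicator B x"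
  note int = integral_u_prim_minorant(1,2)[OF B] and eq = integral_u_prim_minorant(3)[OF B]
  have "integral\<^sup>L P ?\<alpha> = (\<integral>x. (if q x > 0 then ?\<alpha> x else 0) \<partial>P)"
  proof (intro Bochner_Integration.integral_cong refl)
    fix x assume "x \<in> space P"
    moreover have "q x = 0" if "\<not> q x > 0" using that nonneg(2)[of x] by simp
    ultimately show "?\<alpha> x = (if q x > 0 then ?\<alpha> x else 0)"
      using nonneg(1)[of x] by (auto simp: B_def)
  qed
  moreover have "(\<integral>x. (if q x > 0 then ?\<alpha> x * (p x / q x) + ?\<beta> x else 0) \<partial>Q)
      = (\<integral>x. (if q x > 0 then u_prim s (p x / q x) else 0) \<partial>Q)"
    by (intro Bochner_Integration.integral_cong)
      (auto simp: B_def u_prim_def indicator_def field_simps min_def)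
  ultimately show ?thesis
    unfolding gdiv_u_prim[OF assms(1)] eq[symmetric] using integral_ratio(2)[OF int] by simp
qed

end

section \<open>Merging a space into finitely many cells\<close>

lemma (in finite_measure) integral_finite_partition:
  fixes a :: "nat \<Rightarrow> real"
  assumes "finite J" and k: "k \<in> M \<rightarrow>\<^sub>M count_space UNIV" "\<And>x. x \<in> space M \<Longrightarrow> k x \<in> J"
  shows "integrable M (\<lambda>x. a (k x))"
    and "(\<integral>x. a (k x) \<partial>M) = (\<Sum>j\<in>J. a j * measure M {x \<in> space M. k x = j})"
proof -
  note [measurable] = k(1)
  let ?A = "\<lambda>j. {x \<in> space M. k x = j}"
  have eq: "a (k x) = (\<Sum>j\<in>J. a j * indicator (?A j) x)" if "x \<in> space M" for x
    using that assms(1) k(2)[OF that] by (simp add: indicator_def sum.delta' if_distrib cong: if_cong)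
  have int: "integrable M (\<lambda>x. a j * indicator (?A j) x)" for j
    by (intro integrable_mult_right integrable_real_indicator) (auto simp: emeasure_eq_measure)
  have "integrable M (\<lambda>x. a (k x)) \<longleftrightarrow> integrable M (\<lambda>x. \<Sum>j\<in>J. a j * indicator (?A j) x)"
    by (intro Bochner_Integration.integrable_cong refl eq)
  then show "integrable M (\<lambda>x. a (k x))"
    using int by (simp only: Bochner_Integration.integrable_sum)
  have "(\<integral>x. a (k x) \<partial>M) = (\<integral>x. (\<Sum>j\<in>J. a j * indicator (?A j) x) \<partial>M)"
    by (rule Bochner_Integration.integral_cong[OF refl eq])
  also have "\<dots> = (\<Sum>j\<in>J. a j * measure M (?A j))"
    using int by (subst Bochner_Integration.integral_sum) auto
  finally show "(\<integral>x. a (k x) \<partial>M) = (\<Sum>j\<in>J. a j * measure M (?A j))" .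
qed

text \<open>Data processing in dual form: minorants chosen at the atoms pull back along
  \<open>k\<close> to a choice constant on each cell, and \<open>gdiv_ge\<close> bounds the
  resulting linear form by the divergence.\<close>

lemma (in density_pair) feasible_pushforward:
  assumes fs: "\<forall>i\<in>{1..m}. convex_on {0<..} (fs i) \<and> fs i 1 = 0"
    and D: "\<And>i. i \<in> {1..m} \<Longrightarrow> gdiv (fs i) P Q \<le> ereal (D i)"
    and k: "k \<in> N \<rightarrow>\<^sub>M count_space UNIV" "\<And>x. k x \<in> {1..m + 2}"
  shows "feasible m fs D (\<lambda>j. measure P {x \<in> space N. k x = j})
    (\<lambda>j. measure Q {x \<in> space N. k x = j})"
proof -
  have P: "integrable P (\<lambda>x. a (k x))"
      "(\<integral>x. a (k x) \<partial>P) = (\<Sum>j=1..m + 2. a j * measure P {x \<in> space N. k x = j})" for a :: "nat \<Rightarrow> real"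
    using P.integral_finite_partition[of "{1..m + 2}" k a] k
    by (simp_all only: space_P measurable_cong_sets[OF sets_P refl] finite_atLeastAtMost)
  have Q: "integrable Q (\<lambda>x. a (k x))"
      "(\<integral>x. a (k x) \<partial>Q) = (\<Sum>j=1..m + 2. a j * measure Q {x \<in> space N. k x = j})" for a :: "nat \<Rightarrow> real"
    using Q.integral_finite_partition[of "{1..m + 2}" k a] k
    by (simp_all only: space_Q measurable_cong_sets[OF sets_Q refl] finite_atLeastAtMost)
  have "(\<Sum>j=1..m + 2. measure P {x \<in> space N. k x = j}) = 1"
    "(\<Sum>j=1..m + 2. measure Q {x \<in> space N. k x = j}) = 1"
    using P(2)[of "\<lambda>_. 1"] Q(2)[of "\<lambda>_. 1"] P.prob_space Q.prob_space
    by (simp_all del: sum.cl_ivl_Suc)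
  moreover have "(\<Sum>j=1..m + 2. a j * measure P {x \<in> space N. k x = j}
        + b j * measure Q {x \<in> space N. k x = j}) \<le> D i"
    if i: "i \<in> {1..m}" and ab: "\<forall>j\<in>{1..m + 2}. (a j, b j) \<in> affine_minorants (fs i)" for i a b
  proof -
    have "ereal ((\<integral>x. a (k x) \<partial>P) + (\<integral>x. b (k x) \<partial>Q)) \<le> gdiv (fs i) P Q"
      using fs i ab k(2) by (intro gdiv_ge P Q) blast+
    also have "\<dots> \<le> ereal (D i)" by (rule D[OF i])
    finally show ?thesis
      unfolding P Q sum.distrib by (simp only: ereal_less_eq)
  qed
  ultimately show ?thesis
    unfolding feasible_iff[OF fs] by (auto simp only: atLeastAtMost_iff measure_nonneg P.prob_le_1 Q.prob_le_1)
qed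

section \<open>Densities with respect to the sum of two probability measures\<close>

lemma sets_sum_meas: "sets (sum_meas P Q) = sets P"
  by (simp add: sum_meas_def sets.space_closed sets.sigma_sets_eq)

text \<open>A measure built by \<open>measure_of\<close> takes the prescribed values once the set
  function is known to be countably additive.\<close>

lemma emeasure_sum_meas:
  assumes "sets P = sets Q" "A \<in> sets P"
  shows "emeasure (sum_meas P Q) A = emeasure P A + emeasure Q A"
proof (rule emeasure_measure_of[OF sum_meas_def])
  show "countably_additive (sets (sum_meas P Q)) (\<lambda>A. emeasure P A + emeasure Q A)"
  proof (rule countably_additiveI)
    fix A :: "nat \<Rightarrow> 'a set"
    assume A: "range A \<subseteq> sets (sum_meas P Q)" "disjoint_family A"
    then have "range A \<subseteq> sets P" "range A \<subseteq> sets Q"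
      using assms(1) by (simp_all add: sets_sum_meas)
    then show "(\<Sum>i. emeasure P (A i) + emeasure Q (A i)) = emeasure P (\<Union>i. A i) + emeasure Q (\<Union>i. A i)"
      using A(2) by (simp add: suminf_add[symmetric] suminf_emeasure)
  qed
qed (simp_all add: sets_sum_meas sets.space_closed positive_def assms(2))

lemma density_pair_exists:
  assumes P: "prob_space P" and Q: "prob_space Q" and sets: "sets P = sets Q"
  obtains N p q where "density_pair N P Q p q"
proof -
  define N where "N = sum_meas P Q"
  have sets_N: "sets N = sets P" "sets N = sets Q"
    unfolding N_def using sets by (simp_all add: sets_sum_meas)
  interpret P: prob_space P by fact
  interpret Q: prob_space Q by fact
  have N: "emeasure N A = emeasure P A + emeasure Q A" if "A \<in> sets N" for A
    unfolding N_def using that sets sets_N by (intro emeasure_sum_meas) auto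
  interpret N: finite_measure N
    by (rule finite_measureI) (simp add: N P.emeasure_eq_measure Q.emeasure_eq_measure)
  have dens: "R = density N (\<lambda>x. ennreal (enn2real (RN_deriv N R x)))"
    if R: "prob_space R" "sets R = sets N" and ac: "\<And>A. A \<in> sets N \<Longrightarrow> emeasure R A \<le> emeasure N A" for R
  proof -
    interpret R: prob_space R by fact
    have abs: "absolutely_continuous N R"
      unfolding absolutely_continuous_def null_sets_def using ac R(2) by force
    \<comment> \<open>The conversion \<open>enn2real\<close> sends infinity to 0; this alters the
      derivative on a null set only.\<close>
    have "AE x in N. RN_deriv N R x \<noteq> \<infinity>"
      by (rule N.RN_deriv_finite[OF R.sigma_finite_measure_axioms abs R(2)])
    then have "AE x in N. RN_deriv N R x = ennreal (enn2real (RN_deriv N R x))"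
      by eventually_elim (simp add: less_top)
    then have "density N (RN_deriv N R) = density N (\<lambda>x. ennreal (enn2real (RN_deriv N R x)))"
      by (intro density_cong) auto
    then show ?thesis using N.density_RN_deriv[OF abs R(2)] by simp
  qed
  have "density_pair N P Q (\<lambda>x. enn2real (RN_deriv N P x)) (\<lambda>x. enn2real (RN_deriv N Q x))"
    using P Q sets_N by unfold_locales (auto intro!: dens simp: N)
  then show thesis by (rule that)
qed

section \<open>Sign vectors\<close>

text \<open>A nondecreasing vector of signs is determined by the number \<open>k\<close> of its
  leading entries -1, and \<open>k\<close> ranges over \<open>0, ..., m + 2\<close>.\<close>

lemma sign_vectors_eq:
  "sign_vectors m = (\<lambda>k. \<lambda>j\<in>{1..m + 2}. if j \<le> k then -1 else 1) ` {..m + 2}" (is "_ = ?\<sigma> ` _")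
proof (intro equalityI subsetI)
  fix \<sigma> assume \<sigma>: "\<sigma> \<in> sign_vectors m"
  \<comment> \<open>Indices start at 1, so the inserted 0 is the value of \<open>k\<close> when no
    entry equals -1.\<close>
  define k where "k = Max (insert 0 {j \<in> {1..m + 2}. \<sigma> j = -1})"
  have val: "\<sigma> j = (if j \<le> k then -1 else 1)" if j: "j \<in> {1..m + 2}" for j
  proof (cases "j \<le> k")
    case True
    have "k \<in> insert 0 {j \<in> {1..m + 2}. \<sigma> j = -1}"
      unfolding k_def by (rule Max_in) auto
    with True j have k: "k \<in> {1..m + 2}" "\<sigma> k = -1" by auto
    have "\<sigma> j \<le> \<sigma> k"
      using \<sigma> True j k(1) unfolding sign_vectors_def by (blast intro: mono_onD)
    moreover have "\<sigma> j \<in> {-1, 1}" using \<sigma> j by (auto simp: sign_vectors_def)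
    ultimately show ?thesis using True k by auto
  next
    case False
    have "\<sigma> j \<noteq> -1"
    proof
      assume "\<sigma> j = -1"
      then have "j \<le> k" unfolding k_def using j by (intro Max_ge) auto
      with False show False by simp
    qed
    moreover have "\<sigma> j \<in> {-1, 1}" using \<sigma> j by (auto simp: sign_vectors_def)
    ultimately show ?thesis using False by auto
  qed
  have "\<sigma> = ?\<sigma> k"
    using \<sigma> by (intro extensionalityI[where A = "{1..m + 2}"])
      (auto simp: val sign_vectors_def PiE_def)
  moreover have "k \<le> m + 2" unfolding k_def by auto
  ultimately show "\<sigma> \<in> ?\<sigma> ` {..m + 2}" by blast
qed (auto simp: sign_vectors_def mono_on_def)

lemma finite_sign_vectors: "finite (sign_vectors m)"
  by (simp add: sign_vectors_eq)

lemma card_sign_vectors: "card (sign_vectors m) = m + 3"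
proof -
  let ?\<sigma> = "\<lambda>k. \<lambda>j\<in>{1..m + 2}. if j \<le> k then -1 else 1 :: real"
  have less: "?\<sigma> k \<noteq> ?\<sigma> l" if "k < l" "l \<le> m + 2" for k l
  proof
    assume "?\<sigma> k = ?\<sigma> l"
    \<comment> \<open>The two vectors differ at index \<open>l\<close>: the entry is 1 for threshold
      \<open>k < l\<close> and -1 for threshold \<open>l\<close>.\<close>
    then have "?\<sigma> k l = ?\<sigma> l l" by (rule fun_cong)
    then show False using that by simp
  qed
  have "inj_on ?\<sigma> {..m + 2}"
    by (rule linorder_inj_onI) (use less in auto)
  then show ?thesis unfolding sign_vectors_eq by (simp add: card_image)
qed

text \<open>Signs are \<open>2 * indicator J - 1\<close>, and \<open>p - s q\<close> sums to
  \<open>1 - s\<close>, so half the objective is \<open>sum p J - s * sum q J - (1 - s) / 2\<close>.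
  The constants match because \<open>min 1 s = (1 + s - \<bar>s - 1\<bar>) / 2\<close>.\<close>

lemma sign_sum_eq:
  assumes \<sigma>: "\<sigma> \<in> sign_vectors m"
    and sums: "(\<Sum>j=1..m + 2. p j) = 1" "(\<Sum>j=1..m + 2. q j) = 1"
  defines "J \<equiv> {j \<in> {1..m + 2}. \<sigma> j = 1}"
  shows "- \<bar>s - 1\<bar> / 2 + 1 / 2 * (\<Sum>j=1..m + 2. \<sigma> j * (p j - s * q j))
    = min 1 s - 1 + sum p J - s * sum q J"
proof -
  have "\<sigma> j * (p j - s * q j) = 2 * (if \<sigma> j = 1 then p j - s * q j else 0) - (p j - s * q j)"
    if "j \<in> {1..m + 2}" for j
  proof -
    have "\<sigma> j \<in> {-1, 1}" using \<sigma> that by (auto simp: sign_vectors_def)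
    then show ?thesis by auto
  qed
  then have "(\<Sum>j=1..m + 2. \<sigma> j * (p j - s * q j))
      = (\<Sum>j=1..m + 2. 2 * (if \<sigma> j = 1 then p j - s * q j else 0) - (p j - s * q j))"
    by (intro sum.cong) auto
  also have "\<dots> = 2 * (\<Sum>j\<in>J. p j - s * q j) - (\<Sum>j=1..m + 2. p j - s * q j)"
    unfolding J_def sum.inter_filter[OF finite_atLeastAtMost] sum_distrib_left sum_subtractf[symmetric] ..
  also have "\<dots> = 2 * (sum p J - s * sum q J) - (1 - s)"
    by (simp only: sum_subtractf sum_distrib_left[symmetric] sums mult_1_right)
  finally show ?thesis by (auto simp: field_simps min_def abs_if)
qed

section \<open>Atomic measures\<close>

lemma enn2ereal_weighted_sum:
  assumes "\<And>j. j \<in> J \<Longrightarrow> q j \<ge> 0"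
  shows "enn2ereal (\<Sum>j\<in>J. ennreal (q j) * e2ennreal (h j)) = (\<Sum>j\<in>J. ereal (q j) * max 0 (h j))"
proof -
  have "enn2ereal (e2ennreal x) = max 0 x" for x
    by (cases "x \<ge> 0") (auto simp: enn2ereal_e2ennreal e2ennreal_neg max_def zero_ennreal.rep_eq)
  then have "(\<Sum>j\<in>J. ereal (q j) * max 0 (h j)) = (\<Sum>j\<in>J. enn2ereal (ennreal (q j) * e2ennreal (h j)))"
    using assms by (intro sum.cong) (auto simp: times_ennreal.rep_eq enn2ereal_ennreal)
  then show ?thesis by simp
qed

text \<open>Since no \<open>h j\<close> is \<open>-\<infinity>\<close>, the negative parts have a
  finite sum, and the subtraction never meets \<open>\<infinity> - \<infinity>\<close>.\<close>

lemma ereal_weighted_sum_pos_minus_neg: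
  fixes h :: "'i \<Rightarrow> ereal"
  assumes "\<And>j. j \<in> J \<Longrightarrow> q j \<ge> 0" "\<And>j. j \<in> J \<Longrightarrow> h j \<noteq> -\<infinity>"
  shows "(\<Sum>j\<in>J. ereal (q j) * max 0 (h j)) - (\<Sum>j\<in>J. ereal (q j) * max 0 (- h j))
    = (\<Sum>j\<in>J. ereal (q j) * h j)"
proof -
  have "ereal (q j) * h j + ereal (q j) * max 0 (- h j) = ereal (q j) * max 0 (h j)" if "j \<in> J" for j
    using assms that by (cases "h j") (auto simp: max_def zero_ereal_def algebra_simps)
  then have "(\<Sum>j\<in>J. ereal (q j) * max 0 (h j))
      = (\<Sum>j\<in>J. ereal (q j) * h j) + (\<Sum>j\<in>J. ereal (q j) * max 0 (- h j))"
    unfolding sum.distrib[symmetric] by (intro sum.cong) auto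
  moreover have "\<exists>b. ereal (q j) * max 0 (- h j) = ereal b" if "j \<in> J" for j
    using assms(2)[OF that] by (cases "h j") (auto simp: max_def)
  then obtain b where "\<And>j. j \<in> J \<Longrightarrow> ereal (q j) * max 0 (- h j) = ereal (b j)"
    by metis
  then have "(\<Sum>j\<in>J. ereal (q j) * max 0 (- h j)) = ereal (sum b J)"
    by simp
  ultimately show ?thesis
    by (cases "\<Sum>j\<in>J. ereal (q j) * h j") auto
qed

lemma ext_at_zero_not_MInfty:
  assumes "convex_on {0<..} f" "f 1 = 0" "t \<ge> 0"
  shows "ext_at_zero f t \<noteq> -\<infinity>"
proof -
  obtain a b where "(a, b) \<in> affine_minorants f"
    using affine_minorants_nonempty[OF assms(1)] by auto
  from minorant_le_ext_at_zero[OF assms(1,2) this assms(3)] show ?thesis by auto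
qed

text \<open>A density for counting measure on the whole type; \<open>inv_into\<close> recovers the
  index of an atom when \<open>e\<close> is injective on \<open>J\<close>.\<close>

definition atomic_density :: "('i \<Rightarrow> 'a) \<Rightarrow> 'i set \<Rightarrow> ('i \<Rightarrow> real) \<Rightarrow> 'a \<Rightarrow> real" where
  "atomic_density e J w x = (if x \<in> e ` J then w (inv_into J e x) else 0)"

definition atomic_measure :: "('i \<Rightarrow> 'a) \<Rightarrow> 'i set \<Rightarrow> ('i \<Rightarrow> real) \<Rightarrow> 'a measure" where
  "atomic_measure e J w = density (count_space UNIV) (\<lambda>x. ennreal (atomic_density e J w x))"

lemma atomic_density_nonneg:
  "(\<And>j. j \<in> J \<Longrightarrow> w j \<ge> 0) \<Longrightarrow> atomic_density e J w x \<ge> 0"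
  by (auto simp: atomic_density_def inv_into_into)

context
  fixes e :: "'i \<Rightarrow> 'a" and J :: "'i set"
  assumes inj: "inj_on e J" and fin: "finite J"
begin

lemma atomic_density_apply: "j \<in> J \<Longrightarrow> atomic_density e J w (e j) = w j"
  using inj by (simp add: atomic_density_def)

lemma nn_integral_atomic_measure:
  "(\<integral>\<^sup>+x. g x \<partial>atomic_measure e J w) = (\<Sum>j\<in>J. ennreal (w j) * g (e j))"
proof -
  have "(\<integral>\<^sup>+x. g x \<partial>atomic_measure e J w)
      = (\<integral>\<^sup>+x. ennreal (atomic_density e J w x) * g x \<partial>count_space UNIV)"
    unfolding atomic_measure_def by (subst nn_integral_density) auto
  also have "\<dots> = (\<Sum>x\<in>e ` J. ennreal (atomic_density e J w x) * g x)"
    using fin by (intro nn_integral_count_space') (auto simp: atomic_density_def)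
  also have "\<dots> = (\<Sum>j\<in>J. ennreal (w j) * g (e j))"
    using inj by (simp add: sum.reindex atomic_density_apply)
  finally show ?thesis .
qed

lemma emeasure_atomic_measure:
  assumes "\<And>j. j \<in> J \<Longrightarrow> w j \<ge> 0"
  shows "emeasure (atomic_measure e J w) A = ennreal (\<Sum>j\<in>{j \<in> J. e j \<in> A}. w j)"
proof -
  have "A \<in> sets (atomic_measure e J w)" by (simp add: atomic_measure_def)
  then have "emeasure (atomic_measure e J w) A = (\<Sum>j\<in>J. ennreal (w j) * indicator A (e j))"
    by (simp add: nn_integral_indicator[symmetric] nn_integral_atomic_measure del: nn_integral_indicator)
  also have "\<dots> = (\<Sum>j\<in>{j \<in> J. e j \<in> A}. ennreal (w j))"
    unfolding sum.inter_filter[OF fin] by (intro sum.cong) (auto simp: indicator_def)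
  also have "\<dots> = ennreal (\<Sum>j\<in>{j \<in> J. e j \<in> A}. w j)"
    using assms by (intro sum_ennreal) auto
  finally show ?thesis .
qed

lemma measure_atomic_measure:
  assumes "\<And>j. j \<in> J \<Longrightarrow> w j \<ge> 0"
  shows "measure (atomic_measure e J w) A = (\<Sum>j\<in>{j \<in> J. e j \<in> A}. w j)"
  using assms unfolding measure_def
  by (subst emeasure_atomic_measure) (auto intro!: enn2real_ennreal sum_nonneg)

lemma ereal_integral_atomic_measure:
  assumes "\<And>j. j \<in> J \<Longrightarrow> w j \<ge> 0" "\<And>j. j \<in> J \<Longrightarrow> h (e j) \<noteq> -\<infinity>"
  shows "ereal_integral (atomic_measure e J w) h = (\<Sum>j\<in>J. ereal (w j) * h (e j))"
  unfolding ereal_integral_def nn_integral_atomic_measure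
  using assms by (simp add: enn2ereal_weighted_sum ereal_weighted_sum_pos_minus_neg)

lemma density_pair_atomic:
  assumes p: "\<And>j. j \<in> J \<Longrightarrow> p j \<ge> 0" "sum p J = 1" and q: "\<And>j. j \<in> J \<Longrightarrow> q j \<ge> 0" "sum q J = 1"
  shows "density_pair (count_space UNIV) (atomic_measure e J p) (atomic_measure e J q)
    (atomic_density e J p) (atomic_density e J q)"
proof -
  have "prob_space (atomic_measure e J w)"
    if "\<And>j. j \<in> J \<Longrightarrow> w j \<ge> 0" "sum w J = 1" for w
    using that by (intro prob_spaceI) (simp add: emeasure_atomic_measure, simp add: atomic_measure_def)
  then show ?thesis
    using p q unfolding density_pair_def
    by (simp add: atomic_density_nonneg) (simp add: atomic_measure_def)
qed

text \<open>Shows that the constraint expression of \<open>feasible\<close> is itself a divergence,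
  so feasible points give admissible pairs of measures.\<close>

lemma gdiv_atomic:
  assumes p: "\<And>j. j \<in> J \<Longrightarrow> p j \<ge> 0" "sum p J = 1" and q: "\<And>j. j \<in> J \<Longrightarrow> q j \<ge> 0" "sum q J = 1"
    and f: "convex_on {0<..} f" "f 1 = 0"
  shows "gdiv f (atomic_measure e J p) (atomic_measure e J q)
    = (\<Sum>j\<in>{j \<in> J. q j > 0}. ereal (q j) * ext_at_zero f (p j / q j))
        + slope_at_inf f * ereal (\<Sum>j\<in>{j \<in> J. q j = 0}. p j)"
proof -
  let ?p = "atomic_density e J p" and ?q = "atomic_density e J q"
  interpret density_pair "count_space UNIV" "atomic_measure e J p" "atomic_measure e J q" ?p ?q
    by (rule density_pair_atomic[OF p q])
  let ?h = "\<lambda>x. ext_at_zero f (?p x / ?q x) * indicator {x. ?q x > 0} x"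
  have "?h (e j) \<noteq> -\<infinity>" if "j \<in> J" for j
    using that p(1) q(1) ext_at_zero_not_MInfty[OF f, of "p j / q j"]
    by (simp add: atomic_density_apply indicator_def)
  then have "ereal_integral (atomic_measure e J q) ?h = (\<Sum>j\<in>J. ereal (q j) * ?h (e j))"
    using q(1) by (intro ereal_integral_atomic_measure) auto
  also have "\<dots> = (\<Sum>j\<in>{j \<in> J. q j > 0}. ereal (q j) * ext_at_zero f (p j / q j))"
    unfolding sum.inter_filter[OF fin] by (intro sum.cong) (auto simp: atomic_density_apply)
  finally have "ereal_integral (atomic_measure e J q) ?h = \<dots>" .
  moreover have "{j \<in> J. e j \<in> {x \<in> space (atomic_measure e J p). ?q x = 0}} = {j \<in> J. q j = 0}"
    by (auto simp: atomic_density_apply)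
  then have "measure (atomic_measure e J p) {x \<in> space (atomic_measure e J p). ?q x = 0}
      = (\<Sum>j\<in>{j \<in> J. q j = 0}. p j)"
    using p(1) by (simp only: measure_atomic_measure)
  ultimately show ?thesis unfolding gdiv_eq gdiv_formula_def by simp
qed

end

section \<open>The two bounds\<close>

lemma le_opt_value:
  assumes "feasible m fs D p q"
  shows "ereal (\<Sum>j=1..m + 2. \<sigma> j * (p j - s * q j)) \<le> opt_value m s fs D \<sigma>"
  unfolding opt_value_def using assms by (intro Sup_upper) blast

lemma le_max_div:
  fixes P Q :: "'a measure"
  assumes "prob_space P" "prob_space Q" "sets P = sets Q"
    and "\<And>i. i \<in> {1..m} \<Longrightarrow> gdiv (fs i) P Q \<le> ereal (D i)"
  shows "gdiv f P Q \<le> max_div TYPE('a) m f fs D"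
  unfolding max_div_def using assms by (intro Sup_upper) blast

lemma gdiv_u_prim_le_Max_opt_value:
  assumes fs: "\<forall>i\<in>{1..m}. convex_on {0<..} (fs i) \<and> fs i 1 = 0" and "s > 0"
    and PQ: "prob_space P" "prob_space Q" "sets P = sets Q"
    and D: "\<And>i. i \<in> {1..m} \<Longrightarrow> gdiv (fs i) P Q \<le> ereal (D i)"
  shows "gdiv (u_prim s) P Q
    \<le> ereal (- \<bar>s - 1\<bar> / 2) + ereal (1 / 2) * Max (opt_value m s fs D ` sign_vectors m)"
proof -
  obtain N p q where "density_pair N P Q p q"
    using density_pair_exists[OF PQ] .
  then interpret density_pair N P Q p q .
  \<comment> \<open>The cell \<open>p \<ge> s q\<close> is sent to the last index and its complement
    to the first; all other atoms get mass 0. The sign vector below is 1 at the last index only,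
    which is compatible with monotonicity.\<close>
  define k where "k x = (if s * q x \<le> p x then m + 2 else 1)" for x
  have k: "k \<in> N \<rightarrow>\<^sub>M count_space UNIV" unfolding k_def by measurable
  let ?p = "\<lambda>j. measure P {x \<in> space N. k x = j}" and ?q = "\<lambda>j. measure Q {x \<in> space N. k x = j}"
  have feas: "feasible m fs D ?p ?q"
    by (rule feasible_pushforward[OF fs D k]) (auto simp: k_def)
  define \<sigma> :: "nat \<Rightarrow> real" where "\<sigma> = (\<lambda>j\<in>{1..m + 2}. if j \<le> m + 1 then -1 else 1)"
  have \<sigma>: "\<sigma> \<in> sign_vectors m" unfolding sign_vectors_eq \<sigma>_def by (rule image_eqI[of _ _ "m + 1"]) auto
  have J: "{j \<in> {1..m + 2}. \<sigma> j = 1} = {m + 2}" by (auto simp: \<sigma>_def)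
  have B: "{x \<in> space N. k x = m + 2} = {x \<in> space N. s * q x \<le> p x}" by (auto simp: k_def)
  let ?v = "\<Sum>j=1..m + 2. \<sigma> j * (?p j - s * ?q j)"
  have "gdiv (u_prim s) P Q = ereal (min 1 s - 1 + ?p (m + 2) - s * ?q (m + 2))"
    unfolding B by (rule gdiv_u_prim_eq[OF \<open>s > 0\<close>])
  also have "\<dots> = ereal (- \<bar>s - 1\<bar> / 2 + 1 / 2 * ?v)"
    using feas by (subst sign_sum_eq[OF \<sigma>]) (simp_all only: feasible_def J sum.insert[OF finite.emptyI] sum.empty empty_iff not_False_eq_True add_0_right)
  also have "\<dots> = ereal (- \<bar>s - 1\<bar> / 2) + ereal (1 / 2) * ereal ?v"
    by (simp only: plus_ereal.simps times_ereal.simps)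
  also have "\<dots> \<le> ereal (- \<bar>s - 1\<bar> / 2) + ereal (1 / 2) * Max (opt_value m s fs D ` sign_vectors m)"
  proof (intro add_left_mono ereal_mult_left_mono)
    have "ereal ?v \<le> opt_value m s fs D \<sigma>"
      by (rule le_opt_value[OF feas])
    also have "\<dots> \<le> Max (opt_value m s fs D ` sign_vectors m)"
      using \<sigma> finite_sign_vectors by (intro Max_ge) auto
    finally show "ereal ?v \<le> Max (opt_value m s fs D ` sign_vectors m)" .
  qed simp
  finally show ?thesis .
qed

lemma max_div_le_Max_opt_value:
  assumes fs: "\<forall>i\<in>{1..m}. convex_on {0<..} (fs i) \<and> fs i 1 = 0" and "s > 0"
  shows "max_div TYPE('c) m (u_prim s) fs D
    \<le> ereal (- \<bar>s - 1\<bar> / 2) + ereal (1 / 2) * Max (opt_value m s fs D ` sign_vectors m)"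
  unfolding max_div_def
proof (rule Sup_least)
  fix x
  assume "x \<in> {gdiv (u_prim s) P Q | P Q :: 'c measure.
      prob_space P \<and> prob_space Q \<and> sets P = sets Q \<and>
      (\<forall>i\<in>{1..m}. gdiv (fs i) P Q \<le> ereal (D i))}"
  then obtain P Q :: "'c measure" where "x = gdiv (u_prim s) P Q"
    "prob_space P" "prob_space Q" "sets P = sets Q" "\<forall>i\<in>{1..m}. gdiv (fs i) P Q \<le> ereal (D i)"
    by blast
  then show "x \<le> ereal (- \<bar>s - 1\<bar> / 2) + ereal (1 / 2) * Max (opt_value m s fs D ` sign_vectors m)"
    using gdiv_u_prim_le_Max_opt_value[OF fs \<open>s > 0\<close>, of P Q D] by blast
qed

text \<open>An infinite type has room for \<open>m + 2\<close> distinct atoms. A feasible point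
  becomes a pair of atomic measures on them, and the set of atoms of sign 1, inserted into
  \<open>gdiv_u_prim_ge\<close>, yields the objective value.\<close>

lemma opt_value_le_max_div:
  assumes fs: "\<forall>i\<in>{1..m}. convex_on {0<..} (fs i) \<and> fs i 1 = 0" and s: "s > 0"
    and inf: "infinite (UNIV :: 'a set)" and \<sigma>: "\<sigma> \<in> sign_vectors m"
  shows "ereal (- \<bar>s - 1\<bar> / 2) + ereal (1 / 2) * opt_value m s fs D \<sigma> \<le> max_div TYPE('a) m (u_prim s) fs D"
    (is "ereal ?c + _ \<le> ?X")
proof -
  obtain e :: "nat \<Rightarrow> 'a" where "inj e"
    using infinite_countable_subset[OF inf] by auto
  then have inj: "inj_on e {1..m + 2}" by (rule inj_on_subset) simp
  have le: "ereal ?c + ereal (1 / 2) * ereal (\<Sum>j=1..m + 2. \<sigma> j * (p j - s * q j)) \<le> ?X"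
    if feas: "feasible m fs D p q" for p q
  proof -
    let ?P = "atomic_measure e {1..m + 2} p" and ?Q = "atomic_measure e {1..m + 2} q"
    let ?J = "{j \<in> {1..m + 2}. \<sigma> j = 1}"
    have pq: "\<And>j. j \<in> {1..m + 2} \<Longrightarrow> p j \<ge> 0" "(\<Sum>j=1..m + 2. p j) = 1"
      "\<And>j. j \<in> {1..m + 2} \<Longrightarrow> q j \<ge> 0" "(\<Sum>j=1..m + 2. q j) = 1"
      using feas unfolding feasible_def by (auto simp only: atLeastAtMost_iff)
    interpret density_pair "count_space UNIV" ?P ?Q
      "atomic_density e {1..m + 2} p" "atomic_density e {1..m + 2} q"
      by (rule density_pair_atomic[OF inj finite_atLeastAtMost pq])
    have "gdiv (fs i) ?P ?Q \<le> ereal (D i)" if i: "i \<in> {1..m}" for i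
    proof -
      have "convex_on {0<..} (fs i)" "fs i 1 = 0" using fs i by auto
      then show ?thesis
        using feas i unfolding feasible_def
        by (subst gdiv_atomic[OF inj finite_atLeastAtMost pq]) blast+
    qed
    then have upper: "gdiv (u_prim s) ?P ?Q \<le> ?X"
      using prob_space_P prob_space_Q by (intro le_max_div) (simp_all only: sets_P sets_Q)
    have "{j \<in> {1..m + 2}. e j \<in> e ` ?J} = ?J"
      using \<open>inj e\<close> by (auto simp: inj_eq)
    then have meas: "measure (atomic_measure e {1..m + 2} w) (e ` ?J) = sum w ?J"
      if "\<And>j. j \<in> {1..m + 2} \<Longrightarrow> w j \<ge> 0" for w
      using measure_atomic_measure[OF inj finite_atLeastAtMost, of w "e ` ?J"] that by (simp only:)
    have "ereal ?c + ereal (1 / 2) * ereal (\<Sum>j=1..m + 2. \<sigma> j * (p j - s * q j))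
        = ereal (?c + 1 / 2 * (\<Sum>j=1..m + 2. \<sigma> j * (p j - s * q j)))"
      by (simp only: plus_ereal.simps times_ereal.simps)
    also have "\<dots> = ereal (min 1 s - 1 + measure ?P (e ` ?J) - s * measure ?Q (e ` ?J))"
      unfolding sign_sum_eq[OF \<sigma> pq(2,4)] using meas[of p] meas[of q] pq by (simp only:)
    also have "\<dots> \<le> gdiv (u_prim s) ?P ?Q"
      by (rule gdiv_u_prim_ge[OF s]) simp
    also note upper
    finally show ?thesis .
  qed
  show ?thesis
  \<comment> \<open>For finite \<open>x\<close>, the bound \<open>c + v / 2 \<le> x\<close> on each
    objective value is solved for \<open>v\<close> before passing to the supremum. If
    \<open>?X\<close> is \<open>-\<infinity>\<close>, no feasible point exists and the optimal value
    is \<open>-\<infinity>\<close> as well.\<close>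
  proof (cases ?X)
    case (real x)
    have "opt_value m s fs D \<sigma> \<le> ereal (2 * (x - ?c))"
      unfolding opt_value_def
    proof (rule Sup_least)
      have half: "ereal v \<le> ereal (2 * (x - ?c))"
        if "ereal ?c + ereal (1 / 2) * ereal v \<le> ?X" for v
        using that real by (simp add: field_simps)
      fix y
      assume "y \<in> {ereal (\<Sum>j=1..m + 2. \<sigma> j * (p j - s * q j)) | p q. feasible m fs D p q}"
      then show "y \<le> ereal (2 * (x - ?c))" using half[OF le] by blast
    qed
    then have "ereal ?c + ereal (1 / 2) * opt_value m s fs D \<sigma>
        \<le> ereal ?c + ereal (1 / 2) * ereal (2 * (x - ?c))"
      by (intro add_left_mono ereal_mult_left_mono) auto
    also have "\<dots> = ?X" using real by (simp add: field_simps)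
    finally show ?thesis .
  next
    case MInf
    then have "{ereal (\<Sum>j=1..m + 2. \<sigma> j * (p j - s * q j)) | p q. feasible m fs D p q} = {}"
      using le by fastforce
    then have "opt_value m s fs D \<sigma> = -\<infinity>"
      unfolding opt_value_def by (simp only: Sup_empty bot_ereal_def)
    then show ?thesis by simp
  qed simp
qed

theorem theorem6p1:
  fixes m :: nat and fs :: "nat \<Rightarrow> real \<Rightarrow> real" and D :: "nat \<Rightarrow> real" and s :: real
  assumes "m \<ge> 1"
    and "\<And>i. i \<in> {1..m} \<Longrightarrow> convex_on {0<..} (fs i)"
    and "\<And>i. i \<in> {1..m} \<Longrightarrow> fs i 1 = 0"
    and "\<And>i. i \<in> {1..m} \<Longrightarrow> D i \<ge> 0"
    and "s > 0"
    and "infinite (UNIV :: 'a set)"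
  shows "max_div TYPE('a) m (u_prim s) fs D
           = ereal (- \<bar>s - 1\<bar> / 2) + ereal (1 / 2) * Max (opt_value m s fs D ` sign_vectors m)
       \<and> max_div TYPE('b) m (u_prim s) fs D \<le> max_div TYPE('a) m (u_prim s) fs D
       \<and> card (sign_vectors m) = m + 3
       \<and> (\<forall>p q p' q' t. feasible m fs D p q \<and> feasible m fs D p' q' \<and> 0 \<le> t \<and> t \<le> 1 \<longrightarrow>
            feasible m fs D (\<lambda>j. (1 - t) * p j + t * p' j) (\<lambda>j. (1 - t) * q j + t * q' j))"
proof -
  let ?R = "ereal (- \<bar>s - 1\<bar> / 2) + ereal (1 / 2) * Max (opt_value m s fs D ` sign_vectors m)"
  have fs: "\<forall>i\<in>{1..m}. convex_on {0<..} (fs i) \<and> fs i 1 = 0" using assms(2,3) by blast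
  \<comment> \<open>The upper bound holds at every type. Once it is attained at \<open>'a\<close>,
    no type \<open>'b\<close> can give a larger supremum.\<close>
  have upper_a: "max_div TYPE('a) m (u_prim s) fs D \<le> ?R"
    and upper_b: "max_div TYPE('b) m (u_prim s) fs D \<le> ?R"
    by (rule max_div_le_Max_opt_value[OF fs assms(5)])+
  have "sign_vectors m \<noteq> {}" using card_sign_vectors[of m] by auto
  \<comment> \<open>The maximum is attained at some sign vector, so the lower bound for single sign
    vectors suffices.\<close>
  then have "Max (opt_value m s fs D ` sign_vectors m) \<in> opt_value m s fs D ` sign_vectors m"
    using finite_sign_vectors by (intro Max_in) auto
  then have "?R \<le> max_div TYPE('a) m (u_prim s) fs D"
    using opt_value_le_max_div[OF fs assms(5,6)] by auto
  with upper_a have eq: "max_div TYPE('a) m (u_prim s) fs D = ?R" by (rule antisym)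
  show ?thesis
    using eq upper_b card_sign_vectors feasible_convex_combination[OF fs] by metis
qed

end
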